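(* Let $C\subset\mathbb{R}^n$ be an irregular convex polyhedral cone. Then $C$ admits no translation tiling, i.e. there are no compact set $T\subset\mathbb{R}^n$ and discrete set $\mathcal{J}\subset\mathbb{R}^n$ such that $(T,\mathcal{J})$ is a translation tiling of $C$.
   Context: A convex polyhedral cone in $\mathbb{R}^n$ is a set $C=\{\lambda_1\mathbf{a}_1+\cdots+\lambda_m\mathbf{a}_m:\ \lambda_i\ge 0\}$ where $\mathbf{a}_1,\dots,\mathbf{a}_m$ are non-zero vectors for which there is a non-zero $\beta\in\mathbb{R}^n$ with $\langle\mathbf{a}_j,\beta\rangle>0$ for all $j$; one says that $\{\mathbf{a}_1,\dots,\mathbf{a}_m\}$ spans $C$. The dimension $\dim C$ is the dimension of the linear span of $C$. A frame of $C$ is a set that spans $C$ and no proper subset of which spans $C$. $C$ is regular if the cardinality of a frame equals $\dim C$, and irregular otherwise. For $T$ compact and $\mathcal{J}$ (finite or infinite) discrete, $(T,\mathcal{J})$ is a translation tiling of $C$ if $T+\mathcal{J}=C$ and, for all $t_1\neq t_2$ in $\mathcal{J}$, $T+t_1$ and $T+t_2$ are disjoint in Lebesgue measure (their intersection has zero $\dim C$-dimensional Lebesgue measure on the linear span of $C$). *)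

theory Defs
  imports "HOL-Analysis.Analysis"
begin

definition nonneg_combinations :: "'a::euclidean_space set \<Rightarrow> 'a set" where
  "nonneg_combinations A = {\<Sum>a\<in>A. l a *\<^sub>R a | l. \<forall>a\<in>A. 0 \<le> l a}"

definition spans_cone :: "'a::euclidean_space set \<Rightarrow> 'a set \<Rightarrow> bool" where
  "spans_cone A C \<longleftrightarrow>
     finite A \<and> (\<forall>a\<in>A. a \<noteq> 0) \<and> (\<exists>\<beta>. \<beta> \<noteq> 0 \<and> (\<forall>a\<in>A. a \<bullet> \<beta> > 0)) \<and>
     C = nonneg_combinations A"

definition convex_polyhedral_cone :: "'a::euclidean_space set \<Rightarrow> bool" where
  "convex_polyhedral_cone C \<longleftrightarrow> (\<exists>A. spans_cone A C)"

definition frame_of_cone :: "'a::euclidean_space set \<Rightarrow> 'a set \<Rightarrow> bool" where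
  "frame_of_cone F C \<longleftrightarrow> spans_cone F C \<and> (\<forall>G. G \<subset> F \<longrightarrow> \<not> spans_cone G C)"

(* Every convex polyhedral cone has a frame, and it is unique up to positive rescaling of
   its elements, so the choice of the existential quantifier here is immaterial. *)
definition regular_cone :: "'a::euclidean_space set \<Rightarrow> bool" where
  "regular_cone C \<longleftrightarrow>
     convex_polyhedral_cone C \<and> (\<exists>F. frame_of_cone F C \<and> card F = dim (span C))"

definition irregular_cone :: "'a::euclidean_space set \<Rightarrow> bool" where
  "irregular_cone C \<longleftrightarrow> convex_polyhedral_cone C \<and> \<not> regular_cone C"

definition orthonormal_basis_of :: "'a::euclidean_space set \<Rightarrow> 'a set \<Rightarrow> bool" where
  "orthonormal_basis_of V B \<longleftrightarrow>
     pairwise orthogonal B \<and> (\<forall>b\<in>B. norm b = 1) \<and> span B = V"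

lemma orthonormal_basis_of_exists:
  fixes V :: "'a::euclidean_space set"
  assumes "subspace V"
  shows "\<exists>B. orthonormal_basis_of V B"
  using orthonormal_basis_subspace[OF assms] unfolding orthonormal_basis_of_def by metis

lemma orthonormal_basis_of_finite_card:
  fixes V :: "'a::euclidean_space set"
  assumes "orthonormal_basis_of V B"
  shows "finite B" and "card B = dim V"
proof -
  have "0 \<notin> B" using assms unfolding orthonormal_basis_of_def by force
  then have ind: "independent B"
    using assms pairwise_orthogonal_independent unfolding orthonormal_basis_of_def by blast
  then show "finite B" by (rule independent_imp_finite)
  show "card B = dim V"
    using ind assms dim_span_eq_card_independent unfolding orthonormal_basis_of_def by metis
qed

(* The (dim V)-dimensional Lebesgue measure on a linear subspace V, as a measure on the
   ambient space concentrated on V: the completed image of the product measure on B -> R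
   under the linear isometry f |-> (SUM b:B. f b *R b) onto V, for an orthonormal basis B
   of V. This is how the library constructs lborel, with B = Basis. By invariance of
   Lebesgue measure under orthogonal maps the choice of B does not matter. *)
definition lebesgue_subspace :: "'a::euclidean_space set \<Rightarrow> 'a measure" where
  "lebesgue_subspace V =
     (let B = (SOME B. orthonormal_basis_of V B)
      in completion (distr (\<Pi>\<^sub>M b\<in>B. lborel) borel (\<lambda>f. \<Sum>b\<in>B. f b *\<^sub>R b)))"

definition translation_tiling :: "'a::euclidean_space set \<Rightarrow> 'a set \<Rightarrow> 'a set \<Rightarrow> bool" where
  "translation_tiling T J C \<longleftrightarrow>
     compact T \<and> discrete J \<and> T + J = C \<and>
     (\<forall>t\<^sub>1\<in>J. \<forall>t\<^sub>2\<in>J. t\<^sub>1 \<noteq> t\<^sub>2 \<longrightarrow>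
        (\<lambda>x. x + t\<^sub>1) ` T \<inter> (\<lambda>x. x + t\<^sub>2) ` T \<in> null_sets (lebesgue_subspace (span C)))"

end

theory Submission
  imports Defs
begin

text \<open>
  Let \<open>C\<close> be irregular and suppose that \<open>C\<close> is tiled by the translates \<open>T + j\<close> with \<open>j \<in> J\<close>.
  After a translation, \<open>0 \<in> J\<close> and \<open>T, J \<subseteq> C\<close>. The contradiction comes from one two-dimensional
  face of \<open>C\<close> and from two ways of approaching it.

  Geometry. The minimal generators of \<open>C\<close> are linearly dependent, so some facet, cut out by \<open>h \<ge> 0\<close>,
  misses at least two of them, and among the generators with \<open>h > 0\<close> there are two, \<open>a\<close> and \<open>b\<close>,
  that span a face \<open>F\<close> of dimension two. Just beyond the facet lies an open set of directions
  \<open>\<delta> \<notin> C\<close> for which \<open>a + \<delta>\<close> and \<open>b + \<delta>\<close> are still in \<open>C\<close> (lemma \<open>irregular_cone_geometry\<close>).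
  Thus a slice of \<open>C\<close> parallel to \<open>F\<close> may be \<open>F\<close> with its corner cut off. A simplicial
  cone has no such slices.

  Deconvolution. Up to a null set, the tiling says that the sum of the indicator functions of
  \<open>T + j\<close> is that of \<open>C\<close>. Close to \<open>F\<close> only the translations in \<open>J \<inter> F\<close> contribute. The set \<open>J \<inter> F\<close>,
  as a sum of point masses, has a convolution inverse \<open>\<mu>\<close> with integer values on \<open>F\<close>
  (lemma \<open>convolution_inverse\<close>), and so the indicator of \<open>T\<close> near a point
  \<open>p \<in> F\<close> is the sum of \<open>\<mu> q\<close> over those \<open>q\<close> for which the point belongs to \<open>q + C\<close>
  (lemma \<open>deconvolved_germ\<close>). Approaching \<open>p\<close> from inside \<open>C\<close> gives
  \<open>M p = (\<Sum>q \<le> p. \<mu> q)\<close>, where \<open>\<le>\<close> is the componentwise order in the coordinates \<open>a, b\<close>. In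
  the directions \<open>\<delta>\<close> above, the corner of each \<open>q + C\<close> is cut off, so the value is \<open>M p - \<mu> p\<close>.
  Both numbers are values of an indicator function, hence nonnegative, and both vanish far away
  because \<open>T\<close> is bounded. In particular \<open>\<mu>\<close> has finite support.

  Corner. In the top row of the support of \<open>\<mu>\<close> the values \<open>M\<close> vanish. At the rightmost point of
  that row \<open>\<mu>\<close> must therefore be negative; but the entries of the row add up to zero, so that
  just before this point their partial sum is positive, and \<open>M\<close> just below the row is negative
  there (lemma \<open>corner_contradiction\<close>). So \<open>\<mu>\<close> would have empty support, although \<open>\<mu> 0 = 1\<close>.

  The subspace measure enters through the fact that nonempty relatively open sets are not null.
\<close>

section \<open>Finitely generated pointed cones\<close>

lemma nonneg_combinations_eq_hull:
  fixes A :: "'a::euclidean_space set"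
  assumes "finite A"
  shows "nonneg_combinations A = convex_cone hull A"
proof
  show "nonneg_combinations A \<subseteq> convex_cone hull A"
  proof
    fix x assume "x \<in> nonneg_combinations A"
    then obtain l where l: "\<forall>a\<in>A. 0 \<le> l a" and x: "x = (\<Sum>a\<in>A. l a *\<^sub>R a)"
      unfolding nonneg_combinations_def by blast
    have "(\<Sum>a\<in>B. l a *\<^sub>R a) \<in> convex_cone hull A" if "B \<subseteq> A" for B
      using finite_subset[OF that assms] that
    proof (induction B rule: finite_induct)
      case empty
      show ?case by (simp add: convex_cone_hull_contains_0)
    next
      case (insert b B)
      then show ?case
        using l by (simp add: convex_cone_hull_add convex_cone_hull_mul hull_inc)
    qed
    then show "x \<in> convex_cone hull A" using x by blast
  qed
  have "convex_cone (nonneg_combinations A)"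
    unfolding convex_cone_iff
  proof (intro conjI ballI allI impI)
    have "0 = (\<Sum>a\<in>A. 0 *\<^sub>R a)" by simp
    then show "0 \<in> nonneg_combinations A"
      unfolding nonneg_combinations_def by (intro CollectI exI[of _ "\<lambda>a. 0"]) auto
  next
    fix x y assume "x \<in> nonneg_combinations A" "y \<in> nonneg_combinations A"
    then obtain l k where "\<forall>a\<in>A. 0 \<le> l a" "x = (\<Sum>a\<in>A. l a *\<^sub>R a)"
        "\<forall>a\<in>A. 0 \<le> k a" "y = (\<Sum>a\<in>A. k a *\<^sub>R a)"
      unfolding nonneg_combinations_def by blast
    then have "x + y = (\<Sum>a\<in>A. (l a + k a) *\<^sub>R a) \<and> (\<forall>a\<in>A. 0 \<le> l a + k a)"
      by (simp add: scaleR_add_left sum.distrib)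
    then show "x + y \<in> nonneg_combinations A"
      unfolding nonneg_combinations_def by (intro CollectI exI[of _ "\<lambda>a. l a + k a"])
  next
    fix x and c :: real assume "x \<in> nonneg_combinations A" "0 \<le> c"
    then obtain l where "\<forall>a\<in>A. 0 \<le> l a" "x = (\<Sum>a\<in>A. l a *\<^sub>R a)"
      unfolding nonneg_combinations_def by blast
    then have "c *\<^sub>R x = (\<Sum>a\<in>A. (c * l a) *\<^sub>R a) \<and> (\<forall>a\<in>A. 0 \<le> c * l a)"
      using \<open>0 \<le> c\<close> by (simp add: scaleR_sum_right)
    then show "c *\<^sub>R x \<in> nonneg_combinations A"
      unfolding nonneg_combinations_def by (intro CollectI exI[of _ "\<lambda>a. c * l a"])
  qed
  moreover have "A \<subseteq> nonneg_combinations A"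
  proof
    fix b assume "b \<in> A"
    then have "b = (\<Sum>a\<in>A. of_bool (a = b) *\<^sub>R a)"
      using assms by (simp add: of_bool_def if_distrib[of "\<lambda>c. c *\<^sub>R _"] cong: if_cong)
    then show "b \<in> nonneg_combinations A"
      unfolding nonneg_combinations_def by (intro CollectI exI[of _ "\<lambda>a. of_bool (a = b)"]) auto
  qed
  ultimately show "convex_cone hull A \<subseteq> nonneg_combinations A"
    by (rule hull_minimal[rotated])
qed

lemma convex_cone_hull_inner_nonneg:
  fixes A :: "'a::euclidean_space set"
  assumes "x \<in> convex_cone hull A" and "\<And>a. a \<in> A \<Longrightarrow> m \<bullet> a \<ge> 0"
  shows "m \<bullet> x \<ge> 0"
proof -
  have "convex_cone {y. m \<bullet> y \<ge> 0}"
    by (rule convex_cone_halfspace_ge)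
  then have "convex_cone hull A \<subseteq> {y. m \<bullet> y \<ge> 0}"
    using assms(2) by (intro hull_minimal) auto
  then show ?thesis using assms(1) by blast
qed

lemma inner_nonneg_combination:
  assumes "finite A" "x = (\<Sum>a\<in>A. l a *\<^sub>R a)"
  shows "(m::'a::euclidean_space) \<bullet> x = (\<Sum>a\<in>A. l a * (m \<bullet> a))"
  using assms by (simp add: inner_sum_right)

lemma face_of_convex_cone_hull:
  fixes A :: "'a::euclidean_space set"
  assumes "finite A" "x \<in> convex_cone hull A" "\<And>a. a \<in> A \<Longrightarrow> m \<bullet> a \<ge> 0" "m \<bullet> x = 0"
  shows "x \<in> convex_cone hull {a \<in> A. m \<bullet> a = 0}"
proof -
  let ?Z = "{a \<in> A. m \<bullet> a = 0}"
  obtain l where l: "\<forall>a\<in>A. 0 \<le> l a" and x: "x = (\<Sum>a\<in>A. l a *\<^sub>R a)"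
    using assms(2) nonneg_combinations_eq_hull[OF assms(1)] unfolding nonneg_combinations_def by blast
  have "(\<Sum>a\<in>A. l a * (m \<bullet> a)) = 0"
    using inner_nonneg_combination[OF assms(1) x] assms(4) by metis
  then have "\<forall>a\<in>A. l a * (m \<bullet> a) = 0"
    using l assms(1,3) by (subst (asm) sum_nonneg_eq_0_iff) auto
  then have "x = (\<Sum>a\<in>?Z. l a *\<^sub>R a)"
    unfolding x using assms(1) by (intro sum.mono_neutral_right) auto
  then have "x \<in> nonneg_combinations ?Z"
    unfolding nonneg_combinations_def using l by blast
  then show ?thesis
    using nonneg_combinations_eq_hull[of ?Z] assms(1) by simp
qed

lemma closed_convex_cone_hull:
  fixes A :: "'a::euclidean_space set"
  assumes "finite A" "\<And>a. a \<in> A \<Longrightarrow> \<beta> \<bullet> a > 0"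
  shows "closed (convex_cone hull A)"
proof (cases "A = {}")
  case False
  have "convex hull A \<subseteq> {y. \<beta> \<bullet> y > 0}"
    using assms(2) by (intro hull_minimal) (auto simp: convex_halfspace_gt)
  then have "0 \<notin> convex hull A" by auto
  then have "closed (conic hull (convex hull A))"
    using assms(1) by (intro closed_conic_hull disjI2) (simp add: finite_imp_compact_convex_hull)
  then show ?thesis
    using False by (simp add: convex_cone_hull_separate_nonempty)
qed simp

text \<open>Since \<open>\<beta>\<close> is positive on the generators, bounding \<open>\<beta>\<close> on a
  part of the cone bounds that part in norm. This makes \<open>\<beta>\<close> a height function
  with bounded sublevel sets.\<close>
lemma norm_le_inner_on_cone:
  fixes A :: "'a::euclidean_space set"
  assumes "finite A" "\<And>a. a \<in> A \<Longrightarrow> \<beta> \<bullet> a > 0"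
  obtains K where "K > 0" "\<And>x. x \<in> convex_cone hull A \<Longrightarrow> norm x \<le> K * (\<beta> \<bullet> x)"
proof
  define K where "K = 1 + (\<Sum>a\<in>A. norm a / (\<beta> \<bullet> a))"
  have nn: "0 \<le> norm a / (\<beta> \<bullet> a)" if "a \<in> A" for a
    using assms(2)[OF that] by simp
  show "K > 0" unfolding K_def using sum_nonneg[of A "\<lambda>a. norm a / (\<beta> \<bullet> a)"] nn by simp
  fix x assume "x \<in> convex_cone hull A"
  then obtain l where l: "\<forall>a\<in>A. 0 \<le> l a" and x: "x = (\<Sum>a\<in>A. l a *\<^sub>R a)"
    using nonneg_combinations_eq_hull[OF assms(1)] unfolding nonneg_combinations_def by blast
  have le: "norm a \<le> K * (\<beta> \<bullet> a)" if "a \<in> A" for a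
  proof -
    have "norm a / (\<beta> \<bullet> a) \<le> (\<Sum>a\<in>A. norm a / (\<beta> \<bullet> a))"
      using assms(1) nn that by (intro member_le_sum) auto
    then have "norm a / (\<beta> \<bullet> a) \<le> K" unfolding K_def by simp
    then show ?thesis using assms(2)[OF that] by (simp add: pos_divide_le_eq)
  qed
  have "norm x \<le> (\<Sum>a\<in>A. norm (l a *\<^sub>R a))" unfolding x by (rule norm_sum)
  also have "\<dots> = (\<Sum>a\<in>A. l a * norm a)" using l by simp
  also have "\<dots> \<le> (\<Sum>a\<in>A. l a * (K * (\<beta> \<bullet> a)))"
    using l le by (intro sum_mono mult_left_mono) auto
  also have "\<dots> = K * (\<beta> \<bullet> x)"
    unfolding inner_nonneg_combination[OF assms(1) x] by (simp add: sum_distrib_left mult_ac)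
  finally show "norm x \<le> K * (\<beta> \<bullet> x)" .
qed

text \<open>A generating set of least cardinality is a frame. If it were independent its cardinality would
  be the dimension of the cone, which would then be regular.\<close>
lemma irregular_cone_minimal_generators:
  fixes C :: "'a::euclidean_space set"
  assumes "irregular_cone C"
  obtains A \<beta> where "finite A" "C = convex_cone hull A" "\<And>a. a \<in> A \<Longrightarrow> \<beta> \<bullet> a > 0"
    "\<And>a. a \<in> A \<Longrightarrow> a \<notin> convex_cone hull (A - {a})" "dependent A"
proof -
  obtain A0 where A0: "spans_cone A0 C"
    using assms unfolding irregular_cone_def convex_polyhedral_cone_def by blast
  have fin: "finite G" if "spans_cone G C" for G
    using that unfolding spans_cone_def by blast
  obtain A where A: "spans_cone A C" and min: "\<And>G. spans_cone G C \<Longrightarrow> card A \<le> card G"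
    using ex_has_least_nat[of "\<lambda>A. spans_cone A C" A0 card] A0 by blast
  have proper: "\<not> spans_cone G C" if "G \<subset> A" for G
    using psubset_card_mono[OF fin[OF A] that] min[of G] by auto
  then have "frame_of_cone A C"
    unfolding frame_of_cone_def using A by blast
  then have card: "card A \<noteq> dim (span C)"
    using assms A unfolding irregular_cone_def regular_cone_def by blast
  have finA: "finite A" and C: "C = convex_cone hull A"
    using A nonneg_combinations_eq_hull unfolding spans_cone_def by blast+
  obtain \<beta> where \<beta>: "\<beta> \<noteq> 0" "\<forall>a\<in>A. a \<bullet> \<beta> > 0" and nz: "\<forall>a\<in>A. a \<noteq> 0"
    using A unfolding spans_cone_def by blast
  have notin: "a \<notin> convex_cone hull (A - {a})" if "a \<in> A" for a
  proof
    assume "a \<in> convex_cone hull (A - {a})"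
    then have "convex_cone hull (A - {a}) = C"
      unfolding C using hull_redundant[of a convex_cone "A - {a}"] that by (simp add: insert_absorb)
    then have "spans_cone (A - {a}) C"
      unfolding spans_cone_def using finA \<beta> nz
      by (auto simp: nonneg_combinations_eq_hull intro!: exI[of _ \<beta>])
    then show False using proper that by blast
  qed
  have "dependent A"
  proof (rule ccontr)
    assume ind: "\<not> dependent A"
    have "A \<subseteq> C" unfolding C by (rule hull_subset)
    moreover have "C \<subseteq> span A"
      unfolding C by (rule hull_minimal) (auto simp: convex_cone_iff span_base span_zero span_add span_scale)
    ultimately have "span C = span A"
      by (meson span_mono span_minimal subspace_span subset_antisym)
    then show False using card ind by (simp add: dim_eq_card_independent)
  qed
  then show ?thesis
    using that[of A \<beta>] finA C \<beta> notin by (auto simp: inner_commute)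
qed

section \<open>A two-dimensional face that avoids a facet\<close>

text \<open>A generator that the others do not generate spans an exposed ray: the line through it misses the
  convex hull of the other generators, because \<open>\<beta>\<close> rules out negative
  multiples. A functional that separates the two is constant, hence zero, on the line.\<close>
lemma exposed_generator:
  fixes A :: "'a::euclidean_space set"
  assumes "finite A" "\<And>a. a \<in> A \<Longrightarrow> \<beta> \<bullet> a > 0" "a \<in> A" "a \<notin> convex_cone hull (A - {a})"
  obtains m where "m \<bullet> a = 0" "\<And>b. b \<in> A \<Longrightarrow> b \<noteq> a \<Longrightarrow> m \<bullet> b > 0"
proof (cases "A - {a} = {}")
  case True
  then show ?thesis using that[of 0] by auto
next
  case False
  let ?K = "convex hull (A - {a})"
  have "?K \<subseteq> {y. \<beta> \<bullet> y > 0}"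
    using assms(2) by (intro hull_minimal) (auto simp: convex_halfspace_gt)
  have "span {a} \<inter> ?K = {}"
  proof (rule ccontr)
    assume "span {a} \<inter> ?K \<noteq> {}"
    then obtain c where x: "c *\<^sub>R a \<in> ?K" by (auto simp: span_singleton)
    then have "c * (\<beta> \<bullet> a) > 0" using \<open>?K \<subseteq> _\<close> by auto
    then have "c > 0" using assms(2,3) by (metis zero_less_mult_pos2)
    have "c *\<^sub>R a \<in> convex_cone hull (A - {a})"
      using x convex_hull_subset_convex_cone_hull by blast
    then have "(1 / c) *\<^sub>R c *\<^sub>R a \<in> convex_cone hull (A - {a})"
      using \<open>c > 0\<close> convex_cone_hull_mul[of "c *\<^sub>R a" "A - {a}" "1 / c"] by simp
    then show False using assms(4) \<open>c > 0\<close> by simp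
  qed
  moreover have "compact ?K" "?K \<noteq> {}"
    using assms(1) False by (auto simp: finite_imp_compact_convex_hull)
  ultimately obtain m r where m: "\<forall>x\<in>span {a}. m \<bullet> x < r" "\<forall>x\<in>?K. m \<bullet> x > r"
    using separating_hyperplane_closed_compact[of "span {a}" ?K]
    by (meson closed_span convex_convex_hull subspace_imp_convex subspace_span)
  have r: "r > 0" using m(1) span_zero[of "{a}"] by fastforce
  have "m \<bullet> a = 0"
  proof (rule ccontr)
    assume "m \<bullet> a \<noteq> 0"
    moreover have "m \<bullet> ((r / (m \<bullet> a)) *\<^sub>R a) < r"
      using m(1) by (meson span_base span_scale singletonI)
    ultimately show False by simp
  qed
  moreover have "m \<bullet> b > 0" if "b \<in> A" "b \<noteq> a" for b
    using m(2) r that hull_inc[of b "A - {a}" convex] by fastforce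
  ultimately show ?thesis by (rule that)
qed

text \<open>A point of the cone outside its relative interior has a supporting hyperplane, which contains
  the point but not the whole cone.\<close>
lemma rel_interior_convex_cone_hullI:
  fixes A :: "'a::euclidean_space set"
  assumes "x \<in> convex_cone hull A"
    and g0: "\<And>g. (\<And>a. a \<in> A \<Longrightarrow> g \<bullet> a \<ge> 0) \<Longrightarrow> g \<bullet> x = 0 \<Longrightarrow> (\<And>a. a \<in> A \<Longrightarrow> g \<bullet> a = 0)"
  shows "x \<in> rel_interior (convex_cone hull A)"
proof (rule ccontr)
  let ?C = "convex_cone hull A"
  assume "x \<notin> rel_interior ?C"
  then obtain g where g: "\<And>y. y \<in> ?C \<Longrightarrow> g \<bullet> x \<le> g \<bullet> y"
      "\<And>y. y \<in> rel_interior ?C \<Longrightarrow> g \<bullet> x < g \<bullet> y"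
    using supporting_hyperplane_rel_boundary[OF convex_convex_cone_hull assms(1)] by metis
  have le: "g \<bullet> x \<le> g \<bullet> y" if "y \<in> ?C" for y
    using g(1) that by blast
  have "g \<bullet> x \<le> 0" using le[OF convex_cone_hull_contains_0] by simp
  moreover have "g \<bullet> x \<le> g \<bullet> (2 *\<^sub>R x)"
    by (intro le convex_cone_hull_mul assms(1)) simp
  ultimately have gx: "g \<bullet> x = 0" by simp
  have gA: "g \<bullet> a = 0" if "a \<in> A" for a
    by (rule g0[OF _ gx that]) (use le gx in \<open>metis hull_inc\<close>)
  obtain y where y: "y \<in> rel_interior ?C"
    using rel_interior_eq_empty[OF convex_convex_cone_hull, of A] convex_cone_hull_nonempty[of A] by blast
  then have "y \<in> ?C" using rel_interior_subset by blast
  then have "(- g) \<bullet> y \<ge> 0"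
    by (rule convex_cone_hull_inner_nonneg) (simp add: gA)
  then show False using g(2)[OF y] gx by simp
qed

text \<open>The ratio test of linear programming: subtracting more and more of \<open>k\<close> from
  \<open>h\<close> keeps the functional nonnegative until it first vanishes at a generator on
  which \<open>k\<close> is positive.\<close>
lemma tilt_until_new_zero:
  fixes A :: "'a::euclidean_space set"
  assumes "finite A" "\<And>a. a \<in> A \<Longrightarrow> h \<bullet> a \<ge> 0" "b \<in> A" "k \<bullet> b > 0"
  obtains t c where "t \<ge> 0" "c \<in> A" "k \<bullet> c > 0" "(h - t *\<^sub>R k) \<bullet> c = 0"
    "\<And>a. a \<in> A \<Longrightarrow> (h - t *\<^sub>R k) \<bullet> a \<ge> 0"
proof -
  let ?P = "{a \<in> A. k \<bullet> a > 0}"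
  define r where "r a = (h \<bullet> a) / (k \<bullet> a)" for a
  have fin: "finite ?P" and ne: "?P \<noteq> {}" using assms by auto
  obtain c where c: "c \<in> ?P" and min: "\<And>a. a \<in> ?P \<Longrightarrow> r c \<le> r a"
    using ex_min_if_finite[of "r ` ?P"] fin ne
    by (smt (verit, best) arg_min_if_finite(1) arg_min_least)
  have "r c \<ge> 0" using c assms(2) unfolding r_def by simp
  moreover have "(h - r c *\<^sub>R k) \<bullet> c = 0"
    using c unfolding r_def by (simp add: inner_diff_left)
  moreover have "(h - r c *\<^sub>R k) \<bullet> a \<ge> 0" if "a \<in> A" for a
  proof (cases "k \<bullet> a > 0")
    case True
    then have "r c \<le> (h \<bullet> a) / (k \<bullet> a)" using min[of a] that unfolding r_def by simp
    then show ?thesis using True by (simp add: inner_diff_left pos_le_divide_eq)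
  next
    case False
    then have "r c * (k \<bullet> a) \<le> 0" using \<open>r c \<ge> 0\<close> by (simp add: mult_nonneg_nonpos)
    then show ?thesis using assms(2)[OF that] by (simp add: inner_diff_left)
  qed
  ultimately show ?thesis using that[of "r c" c] c by blast
qed

text \<open>Let \<open>u\<close> have a positive coefficient in a linear dependency of the generators. Every
  functional that is nonnegative on the generators and positive at \<open>u\<close> is positive at
  another generator as well, for otherwise it would not vanish on the dependency. Take such an
  \<open>h\<close> with as few positive values as possible and let \<open>p\<close> be the sum of
  its zeros. A nonnegative functional \<open>g\<close> that vanishes at \<open>p\<close> and at a
  further generator is zero: it would itself compete with \<open>h\<close>, or else tilting
  \<open>h\<close> by it would. Hence \<open>p\<close> plus that generator is interior.\<close>
lemma facet_missing_two_generators: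
  fixes A :: "'a::euclidean_space set"
  assumes fin: "finite A" and \<beta>: "\<And>a. a \<in> A \<Longrightarrow> \<beta> \<bullet> a > 0" and "dependent A"
  obtains h u v p where "\<And>a. a \<in> A \<Longrightarrow> h \<bullet> a \<ge> 0" "u \<in> A" "v \<in> A" "u \<noteq> v" "h \<bullet> u > 0" "h \<bullet> v > 0"
    "p \<in> convex_cone hull A" "h \<bullet> p = 0"
    "\<And>a. a \<in> A \<Longrightarrow> h \<bullet> a > 0 \<Longrightarrow> p + a \<in> rel_interior (convex_cone hull A)"
proof -
  obtain c w where c: "(\<Sum>a\<in>A. c a *\<^sub>R a) = 0" "w \<in> A" "c w \<noteq> 0"
    using assms(3) dependent_finite[OF fin] by auto
  have sum0: "(\<Sum>a\<in>A. c a * (g \<bullet> a)) = 0" for g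
    using inner_nonneg_combination[OF fin, of 0 c g] c(1) by simp
  have "\<exists>u\<in>A. c u > 0"
  proof (rule ccontr)
    assume "\<not> (\<exists>u\<in>A. c u > 0)"
    then have nonpos: "\<forall>a\<in>A. c a * (\<beta> \<bullet> a) \<le> 0"
      using \<beta> by (meson linorder_not_less mult_nonpos_nonneg order_less_imp_le)
    have "(\<Sum>a\<in>A. - (c a * (\<beta> \<bullet> a))) = 0" using sum0[of \<beta>] by (simp add: sum_negf)
    then have "\<forall>a\<in>A. - (c a * (\<beta> \<bullet> a)) = 0"
      using nonpos fin by (subst (asm) sum_nonneg_eq_0_iff) auto
    then show False using c(2,3) \<beta>[OF c(2)] by auto
  qed
  then obtain u where u: "u \<in> A" "c u > 0" by blast
  define P where "P h \<longleftrightarrow> (\<forall>a\<in>A. h \<bullet> a \<ge> 0) \<and> h \<bullet> u > 0" for h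
  define N where "N h = {a \<in> A. h \<bullet> a > 0}" for h
  have finN: "finite (N h)" for h unfolding N_def using fin by simp
  have "P \<beta>" unfolding P_def using \<beta> u by (simp add: less_imp_le)
  then obtain h where h: "P h" and min: "\<And>g. P g \<Longrightarrow> card (N h) \<le> card (N g)"
    using ex_has_least_nat[of P \<beta> "\<lambda>h. card (N h)"] by blast
  have nless: "\<not> N g \<subset> N h" if "P g" for g
    using min[OF that] psubset_card_mono[OF finN[of h], of "N g"] by auto
  have hnn: "h \<bullet> a \<ge> 0" if "a \<in> A" for a using h that unfolding P_def by blast
  have "\<exists>v\<in>A. v \<noteq> u \<and> h \<bullet> v > 0"
  proof (rule ccontr)
    assume "\<not> ?thesis"
    then have "\<forall>a\<in>A - {u}. h \<bullet> a = 0" using hnn by force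
    then have "(\<Sum>a\<in>A. c a * (h \<bullet> a)) = c u * (h \<bullet> u)"
      using fin u(1) by (simp add: sum.remove)
    then show False using sum0[of h] u(2) h unfolding P_def by simp
  qed
  then obtain v where v: "v \<in> A" "v \<noteq> u" "h \<bullet> v > 0" by blast
  define Z where "Z = {a \<in> A. h \<bullet> a = 0}"
  define p where "p = \<Sum>Z"
  have finZ: "finite Z" unfolding Z_def using fin by simp
  have gp: "g \<bullet> p = (\<Sum>a\<in>Z. g \<bullet> a)" for g
    unfolding p_def by (simp add: inner_sum_right)
  have "\<Sum>Z = (\<Sum>a\<in>A. of_bool (a \<in> Z) *\<^sub>R a)"
    using fin unfolding Z_def
    by (simp add: of_bool_def if_distrib[of "\<lambda>c. c *\<^sub>R _"] sum.If_cases Int_def cong: if_cong)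
  then have "p \<in> nonneg_combinations A"
    unfolding nonneg_combinations_def p_def by (intro CollectI exI[of _ "\<lambda>a. of_bool (a \<in> Z)"]) auto
  then have pC: "p \<in> convex_cone hull A" using nonneg_combinations_eq_hull[OF fin] by simp
  have "p + a \<in> rel_interior (convex_cone hull A)" if a: "a \<in> A" "h \<bullet> a > 0" for a
  proof (rule rel_interior_convex_cone_hullI)
    show "p + a \<in> convex_cone hull A" using pC a by (simp add: convex_cone_hull_add hull_inc)
    fix g b assume g: "\<And>b. b \<in> A \<Longrightarrow> g \<bullet> b \<ge> 0" and gpa: "g \<bullet> (p + a) = 0" and b: "b \<in> A"
    have "g \<bullet> p \<ge> 0" unfolding gp using g by (intro sum_nonneg) (auto simp: Z_def)
    then have "g \<bullet> a = 0" "g \<bullet> p = 0" using gpa g[OF a(1)] by (auto simp: inner_add_right)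
    then have gZ: "\<forall>z\<in>Z. g \<bullet> z = 0"
      unfolding gp using g finZ by (subst (asm) sum_nonneg_eq_0_iff) (auto simp: Z_def)
    have sub: "h \<bullet> e > 0" if "e \<in> A" "g \<bullet> e > 0" for e
      using gZ hnn[OF that(1)] that unfolding Z_def by force
    have "g \<bullet> u = 0"
    proof (rule ccontr)
      assume "g \<bullet> u \<noteq> 0"
      then have "P g" unfolding P_def using g u by (simp add: less_le)
      moreover have "N g \<subset> N h"
        using sub a \<open>g \<bullet> a = 0\<close> unfolding N_def by force
      ultimately show False using nless by blast
    qed
    show "g \<bullet> b = 0"
    proof (rule ccontr)
      assume "g \<bullet> b \<noteq> 0"
      then have "g \<bullet> b > 0" using g[OF b] by simp
      then obtain t e where t: "t \<ge> 0" "e \<in> A" "g \<bullet> e > 0" "(h - t *\<^sub>R g) \<bullet> e = 0"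
          "\<And>a. a \<in> A \<Longrightarrow> (h - t *\<^sub>R g) \<bullet> a \<ge> 0"
        using tilt_until_new_zero[of A h b g] fin hnn b by blast
      have "P (h - t *\<^sub>R g)"
        using t(5) h \<open>g \<bullet> u = 0\<close> unfolding P_def by (simp add: inner_diff_left)
      moreover have "N (h - t *\<^sub>R g) \<subset> N h"
      proof -
        have "h \<bullet> x > 0" if "x \<in> A" "(h - t *\<^sub>R g) \<bullet> x > 0" for x
        proof -
          have "t * (g \<bullet> x) \<ge> 0" using t(1) g[OF that(1)] by simp
          then show ?thesis using that(2) unfolding inner_diff_left inner_scaleR_left by linarith
        qed
        moreover have "e \<in> N h" "e \<notin> N (h - t *\<^sub>R g)"
          using sub t unfolding N_def by auto
        ultimately show ?thesis unfolding N_def by blast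
      qed
      ultimately show False using nless by blast
    qed
  qed
  moreover have "h \<bullet> p = 0" unfolding gp by (simp add: Z_def)
  ultimately show ?thesis
    using that[of h u v p] hnn u v pC h unfolding P_def by blast
qed

text \<open>The faces of a face are faces: \<open>m + \<epsilon> k\<close> with a small
  \<open>\<epsilon>\<close> is nonnegative when \<open>k\<close> is nonnegative where
  \<open>m\<close> vanishes.\<close>
lemma lex_combination_nonneg:
  fixes A :: "'a::euclidean_space set"
  assumes "finite A" "\<And>a. a \<in> A \<Longrightarrow> m \<bullet> a \<ge> 0" "\<And>a. a \<in> A \<Longrightarrow> m \<bullet> a = 0 \<Longrightarrow> k \<bullet> a \<ge> 0"
  obtains g where "\<And>a. a \<in> A \<Longrightarrow> g \<bullet> a \<ge> 0"
    "\<And>a. a \<in> A \<Longrightarrow> g \<bullet> a = 0 \<longleftrightarrow> m \<bullet> a = 0 \<and> k \<bullet> a = 0"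
proof -
  have "\<forall>\<^sub>F e in at_right 0. m \<bullet> a > 0 \<longrightarrow> (m + e *\<^sub>R k) \<bullet> a > 0" for a
  proof (cases "m \<bullet> a > 0")
    case True
    have "((\<lambda>e. m \<bullet> a + e * (k \<bullet> a)) \<longlongrightarrow> m \<bullet> a + 0 * (k \<bullet> a)) (at_right 0)"
      by (intro tendsto_intros)
    then show ?thesis
      using True order_tendstoD(1)[of "\<lambda>e. m \<bullet> a + e * (k \<bullet> a)" "m \<bullet> a" "at_right 0" 0]
      by (simp add: inner_add_left)
  qed simp
  then have "\<forall>\<^sub>F e in at_right 0. \<forall>a\<in>A. m \<bullet> a > 0 \<longrightarrow> (m + e *\<^sub>R k) \<bullet> a > 0"
    using assms(1) by (simp add: eventually_ball_finite)
  then have "\<forall>\<^sub>F e in at_right 0. e > 0 \<and> (\<forall>a\<in>A. m \<bullet> a > 0 \<longrightarrow> (m + e *\<^sub>R k) \<bullet> a > 0)"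
    using eventually_at_right_less[of "0::real"] by (rule eventually_elim2) blast
  then obtain e :: real where e: "e > 0" "\<And>a. a \<in> A \<Longrightarrow> m \<bullet> a > 0 \<Longrightarrow> (m + e *\<^sub>R k) \<bullet> a > 0"
    by (auto dest: eventually_happens)
  have "(m + e *\<^sub>R k) \<bullet> a \<ge> 0 \<and> ((m + e *\<^sub>R k) \<bullet> a = 0 \<longleftrightarrow> m \<bullet> a = 0 \<and> k \<bullet> a = 0)" if "a \<in> A" for a
  proof (cases "m \<bullet> a = 0")
    case True
    then show ?thesis using assms(3)[OF that] e(1) by (simp add: inner_add_left)
  next
    case False
    then show ?thesis using assms(2)[OF that] e(2)[OF that] by auto
  qed
  then show ?thesis using that[of "m + e *\<^sub>R k"] by blast
qed

text \<open>Both steps rotate a hyperplane that touches the cone along the ray of one generator until it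
  touches another one. For the first, the rotation is steered by a functional that vanishes at
  \<open>u\<close> and is positive at \<open>v\<close> but nowhere on the facet \<open>h =
  0\<close>; all rays of the resulting face are then off the facet. For the second, a face with
  three rays \<open>a, b, d\<close> has a smaller face with at least two rays: steer by a
  functional that is zero at \<open>a\<close>, positive at \<open>d\<close> and negative at
  \<open>b\<close>, which excludes \<open>b\<close>.\<close>
lemma two_face_avoiding_facet:
  fixes A :: "'a::euclidean_space set"
  assumes fin: "finite A"
    and expo: "\<And>a. a \<in> A \<Longrightarrow> \<exists>m. m \<bullet> a = 0 \<and> (\<forall>b\<in>A - {a}. m \<bullet> b > 0)"
    and h: "\<And>a. a \<in> A \<Longrightarrow> h \<bullet> a \<ge> 0"
    and uv: "u \<in> A" "v \<in> A" "u \<noteq> v" "h \<bullet> u > 0" "h \<bullet> v > 0"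
  obtains m a b where "\<And>x. x \<in> A \<Longrightarrow> m \<bullet> x \<ge> 0" "a \<noteq> b" "{x \<in> A. m \<bullet> x = 0} = {a, b}"
    "h \<bullet> a > 0" "h \<bullet> b > 0"
proof -
  obtain e where e0: "\<And>a. a \<in> A \<Longrightarrow> e a \<bullet> a = 0"
      and e1: "\<And>a b. a \<in> A \<Longrightarrow> b \<in> A \<Longrightarrow> b \<noteq> a \<Longrightarrow> e a \<bullet> b > 0"
    using expo by (metis DiffI singletonD)
  have enn: "e a \<bullet> b \<ge> 0" if "a \<in> A" "b \<in> A" for a b
    using e0[of a] e1[OF that] that by (cases "b = a") auto
  define Z where "Z m = {x \<in> A. m \<bullet> x = 0}" for m
  have finZ: "finite (Z m)" for m unfolding Z_def using fin by simp
  define P where "P m \<longleftrightarrow> (\<forall>x\<in>A. m \<bullet> x \<ge> 0) \<and> (\<forall>x\<in>Z m. h \<bullet> x > 0) \<and>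
      (\<exists>x y. x \<noteq> y \<and> x \<in> Z m \<and> y \<in> Z m)" for m
  have "\<exists>m. P m"
  proof -
    \<comment> \<open>\<open>k\<close> vanishes at \<open>u\<close>, and it can only be positive where \<open>h\<close> is.\<close>
    define k where "k = (e v \<bullet> u) *\<^sub>R h - (h \<bullet> u) *\<^sub>R e v"
    have k: "k \<bullet> x = (e v \<bullet> u) * (h \<bullet> x) - (h \<bullet> u) * (e v \<bullet> x)" for x
      unfolding k_def by (simp add: inner_diff_left)
    have "k \<bullet> v > 0" using uv e0 e1 by (simp add: k)
    then obtain t c where t: "t \<ge> 0" "c \<in> A" "k \<bullet> c > 0" "(e u - t *\<^sub>R k) \<bullet> c = 0"
        "\<And>a. a \<in> A \<Longrightarrow> (e u - t *\<^sub>R k) \<bullet> a \<ge> 0"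
      using tilt_until_new_zero[of A "e u" v k] fin enn uv by blast
    let ?m = "e u - t *\<^sub>R k"
    have ku: "k \<bullet> u = 0" by (simp add: k)
    have "h \<bullet> x > 0" if x: "x \<in> A" "?m \<bullet> x = 0" for x
    proof (cases "x = u")
      case False
      then have "t * (k \<bullet> x) > 0" using e1[OF uv(1) x(1)] x(2) by (simp add: inner_diff_left)
      then have "k \<bullet> x > 0" using t(1) by (metis less_eq_real_def mult_zero_left zero_less_mult_pos less_irrefl)
      moreover have "(h \<bullet> u) * (e v \<bullet> x) \<ge> 0" using uv enn x by simp
      ultimately have "(e v \<bullet> u) * (h \<bullet> x) > 0" unfolding k by simp
      then show ?thesis using h[OF x(1)] by (metis less_eq_real_def mult_zero_right)
    qed (use uv in simp)
    moreover have "u \<in> Z ?m" "c \<in> Z ?m" "u \<noteq> c"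
      using t uv e0 ku unfolding Z_def by (auto simp: inner_diff_left)
    ultimately have "P ?m" using t(5) unfolding P_def Z_def by blast
    then show ?thesis by blast
  qed
  then obtain m where m: "P m" and min: "\<And>g. P g \<Longrightarrow> card (Z m) \<le> card (Z g)"
    using ex_has_least_nat[of P _ "\<lambda>m. card (Z m)"] by blast
  have nless: "\<not> Z g \<subset> Z m" if "P g" for g
    using min[OF that] psubset_card_mono[OF finZ[of m], of "Z g"] by auto
  obtain a b where ab: "a \<noteq> b" "a \<in> Z m" "b \<in> Z m" using m unfolding P_def by blast
  have "Z m \<subseteq> {a, b}"
  proof (rule ccontr)
    assume "\<not> ?thesis"
    then obtain d where d: "d \<in> Z m" "d \<noteq> a" "d \<noteq> b" by blast
    have A: "a \<in> A" "b \<in> A" "d \<in> A" using ab d unfolding Z_def by auto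
    define k where "k = (e d \<bullet> a) *\<^sub>R e b - (e b \<bullet> a) *\<^sub>R e d"
    have k: "k \<bullet> x = (e d \<bullet> a) * (e b \<bullet> x) - (e b \<bullet> a) * (e d \<bullet> x)" for x
      unfolding k_def by (simp add: inner_diff_left)
    have ka: "k \<bullet> a = 0" by (simp add: k)
    have kd: "k \<bullet> d > 0" using A ab(1) d e0 e1 by (simp add: k)
    have kb: "k \<bullet> b < 0" using A ab(1) d e0 e1 by (simp add: k)
    obtain t c where t: "t \<ge> 0" "c \<in> Z m" "k \<bullet> c > 0" "(e a - t *\<^sub>R k) \<bullet> c = 0"
        "\<And>x. x \<in> Z m \<Longrightarrow> (e a - t *\<^sub>R k) \<bullet> x \<ge> 0"
      using tilt_until_new_zero[of "Z m" "e a" d k] finZ enn A(1) d(1) kd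
      by (metis (no_types, lifting) Z_def mem_Collect_eq)
    have pos: "(e a - t *\<^sub>R k) \<bullet> b > 0"
      using e1[OF A(1,2)] ab(1) kb t(1) mult_nonneg_nonpos[of t "k \<bullet> b"] by (simp add: inner_diff_left)
    obtain g where g: "\<And>x. x \<in> A \<Longrightarrow> g \<bullet> x \<ge> 0"
        "\<And>x. x \<in> A \<Longrightarrow> g \<bullet> x = 0 \<longleftrightarrow> m \<bullet> x = 0 \<and> (e a - t *\<^sub>R k) \<bullet> x = 0"
      using lex_combination_nonneg[of A m "e a - t *\<^sub>R k"] fin m t(5) unfolding P_def Z_def by blast
    have "a \<in> Z g" "c \<in> Z g" "a \<noteq> c"
      using g(2) A(1) ab t ka e0[OF A(1)] unfolding Z_def by (auto simp: inner_diff_left)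
    moreover have sub: "Z g \<subseteq> Z m" using g(2) unfolding Z_def by blast
    ultimately have "P g" using g(1) m unfolding P_def by blast
    moreover have "b \<notin> Z g" using pos g(2) A(2) unfolding Z_def by auto
    ultimately show False using sub nless ab(3) by blast
  qed
  then have "{x \<in> A. m \<bullet> x = 0} = {a, b}" using ab unfolding Z_def by blast
  then show ?thesis using that[of m a b] m ab unfolding P_def by blast
qed

lemma openin_subspace_affinity:
  fixes V :: "'a::euclidean_space set"
  assumes V: "subspace V" and "y \<in> V" "s \<noteq> 0" "openin (top_of_set V) W"
  shows "openin (top_of_set V) ((\<lambda>x. y + s *\<^sub>R x) ` W)"
proof -
  obtain O' where O: "open O'" "W = V \<inter> O'" using assms(4) by (auto simp: openin_open)
  have "(\<lambda>x. y + s *\<^sub>R x) ` W = V \<inter> (\<lambda>x. y + s *\<^sub>R x) ` O'"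
  proof (intro equalityI subsetI)
    fix z assume "z \<in> (\<lambda>x. y + s *\<^sub>R x) ` W"
    then show "z \<in> V \<inter> (\<lambda>x. y + s *\<^sub>R x) ` O'"
      using O(2) assms(2) V by (auto simp: subspace_add subspace_scale)
  next
    fix z assume "z \<in> V \<inter> (\<lambda>x. y + s *\<^sub>R x) ` O'"
    then obtain x where x: "x \<in> O'" "z = y + s *\<^sub>R x" "z \<in> V" by blast
    then have "x = (1 / s) *\<^sub>R (z - y)" using assms(3) by simp
    then have "x \<in> V" using x(3) assms(2) V by (simp add: subspace_diff subspace_scale)
    then show "z \<in> (\<lambda>x. y + s *\<^sub>R x) ` W" using x O(2) by blast
  qed
  moreover have "open ((\<lambda>x. y + s *\<^sub>R x) ` O')"
    using open_affinity[OF O(1) assms(3)] by simp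
  ultimately show ?thesis by (auto simp: openin_open)
qed

text \<open>The facet \<open>h = 0\<close> that misses two generators contains a point \<open>p\<close> with
  \<open>p + a\<close> and \<open>p + b\<close> in the relative interior of \<open>C\<close>, for
  the generators \<open>a\<close> and \<open>b\<close> of a two-dimensional face that avoids it.
  So the directions \<open>D\<close> can be taken near \<open>p\<close>, on the other side of the
  facet; there are such directions in the span, for instance \<open>p\<close> minus a small
  multiple of \<open>a\<close>.\<close>
lemma irregular_cone_geometry:
  fixes C :: "'a::euclidean_space set"
  assumes "irregular_cone C"
  obtains A \<beta> m a b D where "finite A" "C = convex_cone hull A" "\<And>x. x \<in> A \<Longrightarrow> \<beta> \<bullet> x > 0"
    "a \<in> A" "b \<in> A" "\<And>x. x \<in> C \<Longrightarrow> m \<bullet> x \<ge> 0" "m \<bullet> a = 0" "m \<bullet> b = 0"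
    "\<And>x. x \<in> C \<Longrightarrow> m \<bullet> x = 0 \<Longrightarrow> \<exists>s t. x = s *\<^sub>R a + t *\<^sub>R b"
    "\<And>s t. s *\<^sub>R a + t *\<^sub>R b \<in> C \<longleftrightarrow> s \<ge> 0 \<and> t \<ge> 0"
    "openin (top_of_set (span C)) D" "D \<noteq> {}" "bounded D"
    "\<And>x. x \<in> D \<Longrightarrow> x \<notin> C \<and> x + a \<in> C \<and> x + b \<in> C"
proof -
  obtain A \<beta> where A: "finite A" "C = convex_cone hull A" and \<beta>: "\<And>a. a \<in> A \<Longrightarrow> \<beta> \<bullet> a > 0"
    and min: "\<And>a. a \<in> A \<Longrightarrow> a \<notin> convex_cone hull (A - {a})" and dep: "dependent A"
    using irregular_cone_minimal_generators[OF assms] by metis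
  have expo: "\<exists>m. m \<bullet> a = 0 \<and> (\<forall>b\<in>A - {a}. m \<bullet> b > 0)" if "a \<in> A" for a
    using exposed_generator[OF A(1) \<beta> that min[OF that]] by (metis DiffE singletonI)
  have nonneg: "g \<bullet> x \<ge> 0" if "\<And>a. a \<in> A \<Longrightarrow> g \<bullet> a \<ge> 0" "x \<in> C" for g x
    using convex_cone_hull_inner_nonneg that unfolding A(2) by blast
  have AC: "A \<subseteq> C" unfolding A(2) by (rule hull_subset)
  obtain h u v p where h: "\<And>a. a \<in> A \<Longrightarrow> h \<bullet> a \<ge> 0" and uv: "u \<in> A" "v \<in> A" "u \<noteq> v" "h \<bullet> u > 0" "h \<bullet> v > 0"
    and p: "p \<in> C" "h \<bullet> p = 0" "\<And>a. a \<in> A \<Longrightarrow> h \<bullet> a > 0 \<Longrightarrow> p + a \<in> rel_interior C"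
    using facet_missing_two_generators[OF A(1) \<beta> dep] unfolding A(2)[symmetric] by metis
  obtain m a b where m: "\<And>x. x \<in> A \<Longrightarrow> m \<bullet> x \<ge> 0" and ab: "a \<noteq> b" "{x \<in> A. m \<bullet> x = 0} = {a, b}"
    "h \<bullet> a > 0" "h \<bullet> b > 0"
    using two_face_avoiding_facet[OF A(1) expo h uv] by metis
  have abA: "a \<in> A" "b \<in> A" "m \<bullet> a = 0" "m \<bullet> b = 0" using ab(2) by auto
  have mC: "m \<bullet> x \<ge> 0" if "x \<in> C" for x using nonneg[OF m that] .
  have face: "\<exists>s t. x = s *\<^sub>R a + t *\<^sub>R b" if x: "x \<in> C" "m \<bullet> x = 0" for x
  proof -
    have "x \<in> convex_cone hull {a, b}"
      using face_of_convex_cone_hull[OF A(1) _ m x(2)] x(1) unfolding ab(2) A(2) by blast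
    then obtain l where "x = (\<Sum>a\<in>{a, b}. l a *\<^sub>R a)"
      using nonneg_combinations_eq_hull[of "{a, b}"] unfolding nonneg_combinations_def by auto
    then show ?thesis using ab(1) by auto
  qed
  have coords: "s *\<^sub>R a + t *\<^sub>R b \<in> C \<longleftrightarrow> s \<ge> 0 \<and> t \<ge> 0" for s t
  proof
    assume in_C: "s *\<^sub>R a + t *\<^sub>R b \<in> C"
    have *: "r \<ge> 0" if "x \<in> A" "y \<in> A" "x \<noteq> y" "q *\<^sub>R x + r *\<^sub>R y \<in> C" for x y q r
    proof -
      obtain e where e: "e \<bullet> x = 0" "\<forall>b\<in>A - {x}. e \<bullet> b > 0" using expo[OF \<open>x \<in> A\<close>] by blast
      then have "e \<bullet> y > 0" using that by blast
      moreover have "e \<bullet> z \<ge> 0" if "z \<in> A" for z using e that by (cases "z = x") (auto simp: less_imp_le)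
      then have "e \<bullet> (q *\<^sub>R x + r *\<^sub>R y) \<ge> 0" using nonneg that(4) by blast
      ultimately show ?thesis using e(1) by (simp add: inner_add_right zero_le_mult_iff)
    qed
    show "s \<ge> 0 \<and> t \<ge> 0"
      using *[OF abA(1,2) ab(1) in_C] *[OF abA(2,1), of t s] ab(1) in_C by (simp add: add.commute)
  next
    assume "s \<ge> 0 \<and> t \<ge> 0"
    then show "s *\<^sub>R a + t *\<^sub>R b \<in> C"
      using abA unfolding A(2) by (simp add: convex_cone_hull_add convex_cone_hull_mul hull_inc)
  qed
  let ?V = "span C"
  have CV: "C \<subseteq> ?V" by (rule span_superset)
  have C0: "0 \<in> C" unfolding A(2) by (rule convex_cone_hull_contains_0)
  have aff: "affine hull C = ?V" using C0 by (intro affine_hull_span_0 hull_inc)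
  have "openin (top_of_set ?V) (rel_interior C)" unfolding aff[symmetric] by (rule openin_rel_interior)
  then have open_shift: "openin (top_of_set ?V) ((\<lambda>x. - y + 1 *\<^sub>R x) ` rel_interior C)" if "y \<in> C" for y
    using that CV by (intro openin_subspace_affinity) (auto intro: span_neg)
  have shift: "x \<in> (\<lambda>x. - y + 1 *\<^sub>R x) ` rel_interior C \<longleftrightarrow> x + y \<in> rel_interior C" for x y
    by (auto simp: image_iff algebra_simps intro!: bexI[of _ "x + y"])
  define E where "E = (\<lambda>x. - a + 1 *\<^sub>R x) ` rel_interior C \<inter> (\<lambda>x. - b + 1 *\<^sub>R x) ` rel_interior C"
  have E: "openin (top_of_set ?V) E" unfolding E_def using open_shift abA AC by blast
  have E_iff: "x \<in> E \<longleftrightarrow> x + a \<in> rel_interior C \<and> x + b \<in> rel_interior C" for x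
    unfolding E_def using shift by blast
  have "p \<in> E" unfolding E_iff using p(3) abA ab by blast
  then obtain e where e: "e > 0" "ball p e \<inter> ?V \<subseteq> E" using E unfolding openin_contains_ball by blast
  define D where "D = E \<inter> {x. h \<bullet> x < 0} \<inter> ball p e"
  have "openin (top_of_set ?V) D"
    unfolding D_def using E by (intro openin_Int_open open_halfspace_lt open_ball)
  moreover have "D \<noteq> {}"
  proof -
    define d where "d = e / (2 * norm a)"
    have "a \<noteq> 0" using ab(3) by auto
    then have "d > 0" unfolding d_def using e(1) by simp
    have "norm (d *\<^sub>R a) < e" unfolding d_def using e(1) \<open>a \<noteq> 0\<close> by simp
    then have "p - d *\<^sub>R a \<in> ball p e" by (simp add: dist_norm)
    moreover have "p - d *\<^sub>R a \<in> ?V"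
      using p(1) abA(1) AC CV by (intro span_diff span_scale) auto
    moreover have "h \<bullet> (p - d *\<^sub>R a) < 0" using p(2) ab(3) \<open>d > 0\<close> by (simp add: inner_diff_right)
    ultimately show ?thesis unfolding D_def using e(2) by blast
  qed
  moreover have "bounded D" unfolding D_def by (simp add: bounded_Int)
  moreover have "x \<notin> C \<and> x + a \<in> C \<and> x + b \<in> C" if "x \<in> D" for x
  proof -
    have "x \<in> E" "h \<bullet> x < 0" using that unfolding D_def by auto
    then show ?thesis using nonneg[OF h, of x] E_iff rel_interior_subset by (metis linorder_not_less subsetD)
  qed
  ultimately show ?thesis using that[OF A \<beta> abA(1,2) mC abA(3,4) face coords] by blast
qed

section \<open>Null sets of the subspace measure\<close>

text \<open>A relatively open set contains the image, under the orthonormal coordinates that define the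
  measure, of a box of positive volume.\<close>
lemma openin_subspace_not_null:
  fixes V :: "'a::euclidean_space set"
  assumes V: "subspace V" and W: "openin (top_of_set V) W" "W \<noteq> {}" and "W \<subseteq> X"
  shows "X \<notin> null_sets (lebesgue_subspace V)"
proof
  assume X: "X \<in> null_sets (lebesgue_subspace V)"
  define B where "B = (SOME B. orthonormal_basis_of V B)"
  have B: "orthonormal_basis_of V B"
    unfolding B_def using orthonormal_basis_of_exists[OF V] by (rule someI_ex)
  then have fin: "finite B" and orth: "pairwise orthogonal B" and norm1: "\<And>b. b \<in> B \<Longrightarrow> norm b = 1"
      and span: "span B = V"
    using orthonormal_basis_of_finite_card(1) unfolding orthonormal_basis_of_def by blast+
  define P where "P = (\<Pi>\<^sub>M b\<in>B. (lborel :: real measure))"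
  define \<phi> where "\<phi> f = (\<Sum>b\<in>B. f b *\<^sub>R b)" for f :: "'a \<Rightarrow> real"
  have meas: "\<phi> \<in> measurable P borel"
    unfolding \<phi>_def P_def by measurable
  have "lebesgue_subspace V = completion (distr P borel \<phi>)"
    unfolding lebesgue_subspace_def Let_def B_def P_def \<phi>_def ..
  then obtain N where N: "N \<in> null_sets (distr P borel \<phi>)" "X \<subseteq> N"
    using X by (auto simp: null_sets_completion_iff2)
  then have null: "emeasure P (\<phi> -` N \<inter> space P) = 0" and Nb: "N \<in> sets borel"
    using meas by (auto simp: null_sets_def emeasure_distr)
  obtain w where "w \<in> W" using W(2) by blast
  obtain e where e: "e > 0" "ball w e \<inter> V \<subseteq> W"
    using W(1) \<open>w \<in> W\<close> unfolding openin_contains_ball by blast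
  have "w \<in> span B" using W(1) \<open>w \<in> W\<close> span openin_imp_subset by blast
  then have w: "w = \<phi> (\<lambda>b. w \<bullet> b)"
    unfolding \<phi>_def using orthonormal_basis_expand[OF orth norm1 _ fin] by simp
  define d where "d = e / (card B + 1)"
  have d: "d > 0" unfolding d_def using e(1) by simp
  have de: "card B * d < e" unfolding d_def using e(1) by (simp add: field_simps)
  define E where "E = (\<Pi>\<^sub>E b\<in>B. {w \<bullet> b - d <..< w \<bullet> b + d})"
  have "E \<subseteq> \<phi> -` N \<inter> space P"
  proof
    fix f assume f: "f \<in> E"
    have "\<phi> f - w = (\<Sum>b\<in>B. (f b - w \<bullet> b) *\<^sub>R b)"
      by (subst w) (simp add: \<phi>_def sum_subtractf scaleR_diff_left)
    then have "norm (\<phi> f - w) \<le> (\<Sum>b\<in>B. norm ((f b - w \<bullet> b) *\<^sub>R b))"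
      by (simp only: norm_sum)
    also have "\<dots> \<le> (\<Sum>b\<in>B. d)"
    proof (rule sum_mono)
      fix b assume b: "b \<in> B"
      then have "f b \<in> {w \<bullet> b - d <..< w \<bullet> b + d}" using f unfolding E_def by blast
      then show "norm ((f b - w \<bullet> b) *\<^sub>R b) \<le> d" using norm1[OF b] by auto
    qed
    also have "\<dots> < e" using de by simp
    finally have "\<phi> f \<in> ball w e" by (simp add: dist_norm norm_minus_commute)
    moreover have "\<phi> f \<in> V"
      unfolding \<phi>_def span[symmetric] by (intro span_sum span_scale span_base)
    ultimately have "\<phi> f \<in> N" using e(2) assms(4) N(2) by blast
    then show "f \<in> \<phi> -` N \<inter> space P"
      using f unfolding P_def E_def by (auto simp: space_PiM PiE_def Pi_def)
  qed
  then have "emeasure P E \<le> emeasure P (\<phi> -` N \<inter> space P)"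
    using meas Nb by (intro emeasure_mono) (auto intro: measurable_sets)
  moreover interpret product_sigma_finite "\<lambda>b::'a. lborel :: real measure"
    by standard
  have "emeasure P E = (\<Prod>b\<in>B. ennreal (2 * d))"
    unfolding P_def E_def using fin d by (subst emeasure_PiM) auto
  ultimately show False
    using null fin d by (simp add: prod_zero_iff)
qed

section \<open>The top row of a finitely supported function on the plane\<close>

text \<open>Think of \<open>M\<close> as the distribution function of the signed measure \<open>g\<close>.
  At the rightmost point \<open>(X, Y)\<close> of the top row, \<open>M\<close> is zero, which
  makes \<open>g (X, Y)\<close> negative by \<open>Mg\<close>. The whole row has sum zero, since
  \<open>M\<close> vanishes far to the right both on the row and just below it. To the left of
  \<open>X\<close> the row then has the positive sum \<open>- g (X, Y)\<close>, and
  \<open>M\<close> just below the row has to compensate it.\<close>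
lemma corner_contradiction:
  fixes G :: "(real \<times> real) set" and g :: "real \<times> real \<Rightarrow> int"
  assumes fin: "finite G" and ne: "G \<noteq> {}" and nz: "\<And>q. q \<in> G \<Longrightarrow> g q \<noteq> 0"
    and M: "\<And>x y. M x y = (\<Sum>q | q \<in> G \<and> fst q \<le> x \<and> snd q \<le> y. g q)"
    and M0: "\<And>x y. M x y \<ge> 0" and Mg: "\<And>x y. (x, y) \<in> G \<Longrightarrow> M x y - g (x, y) \<ge> 0"
    and bounded: "\<And>x y. x \<ge> R \<or> y \<ge> R \<Longrightarrow> M x y = 0"
  shows False
proof -
  have below: "\<exists>s<t. \<forall>r\<in>S. r < t \<longrightarrow> r \<le> s" if "finite S" for S :: "real set" and t
  proof -
    let ?s = "Max (insert (t - 1) {r \<in> S. r < t})"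
    have "?s < t" using that by (subst Max_less_iff) auto
    moreover have "\<forall>r\<in>S. r < t \<longrightarrow> r \<le> ?s" using that by (auto intro: Max_ge)
    ultimately show ?thesis by blast
  qed
  define Y where "Y = Max (snd ` G)"
  have Y: "snd q \<le> Y" if "q \<in> G" for q unfolding Y_def using fin that by simp
  define H where "H = {q \<in> G. snd q = Y}"
  have "Y \<in> snd ` G" unfolding Y_def using fin ne by simp
  then have H: "finite H" "H \<noteq> {}" unfolding H_def using fin by auto
  define X where "X = Max (fst ` H)"
  have X: "fst q \<le> X" if "q \<in> H" for q unfolding X_def using H(1) that by simp
  have "X \<in> fst ` H" unfolding X_def using H by simp
  then have XY: "(X, Y) \<in> H" unfolding H_def by force
  \<comment> \<open>The height \<open>y\<close> separates the top row from all lower ones; likewise \<open>x\<close> separates the last point of the row.\<close>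
  obtain y where y: "y < Y" "\<And>q. q \<in> G \<Longrightarrow> snd q < Y \<Longrightarrow> snd q \<le> y"
    using below[of "snd ` G" Y] fin by blast
  obtain x where x: "x < X" "\<And>q. q \<in> H \<Longrightarrow> fst q < X \<Longrightarrow> fst q \<le> x"
    using below[of "fst ` H" X] H by blast
  have top: "M t Y = 0" for t
  proof -
    have "M t Y = M t (max R Y)"
      unfolding M using Y by (intro sum.cong) (auto intro: order_trans max.cobounded2)
    then show ?thesis using bounded by simp
  qed
  have split: "M t y + (\<Sum>q | q \<in> H \<and> fst q \<le> t. g q) = 0" for t
  proof -
    have "{q. q \<in> G \<and> fst q \<le> t \<and> snd q \<le> Y} =
        {q. q \<in> G \<and> fst q \<le> t \<and> snd q \<le> y} \<union> {q. q \<in> H \<and> fst q \<le> t}"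
      using y Y unfolding H_def by force
    moreover have "{q. q \<in> G \<and> fst q \<le> t \<and> snd q \<le> y} \<inter> {q. q \<in> H \<and> fst q \<le> t} = {}"
      using y(1) unfolding H_def by auto
    ultimately have "M t Y = M t y + (\<Sum>q | q \<in> H \<and> fst q \<le> t. g q)"
      unfolding M using fin H(1) by (simp add: sum.union_disjoint)
    then show ?thesis using top by simp
  qed
  have neg: "g (X, Y) < 0"
    using Mg[of X Y] top[of X] nz[of "(X, Y)"] XY unfolding H_def by force
  have "(\<Sum>q\<in>H. g q) = 0"
  proof -
    have "{q. q \<in> H \<and> fst q \<le> max R X} = H" using X by (auto intro!: max.coboundedI2)
    then show ?thesis using split[of "max R X"] bounded[of "max R X" y] by simp
  qed
  moreover have "{q. q \<in> H \<and> fst q \<le> x} = H - {(X, Y)}"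
    using x X XY unfolding H_def by force
  ultimately have "(\<Sum>q | q \<in> H \<and> fst q \<le> x. g q) = - g (X, Y)"
    using H(1) XY by (simp add: sum_diff1)
  then show False using split[of x] M0[of x y] neg by linarith
qed

section \<open>Convolution inverse of a locally finite set\<close>

text \<open>Partial sums of the Neumann series for the inverse of the point masses at \<open>0\<close> and at all of \<open>J\<close>.
  The restriction to \<open>val j \<le> val q\<close> makes the sums finite; the omitted terms vanish.\<close>
primrec neumann :: "('a::ab_group_add \<Rightarrow> real) \<Rightarrow> 'a set \<Rightarrow> nat \<Rightarrow> 'a \<Rightarrow> int" where
  "neumann val J 0 q = 0"
| "neumann val J (Suc n) q = of_bool (q = 0) - (\<Sum>j | j \<in> J \<and> val j \<le> val q. neumann val J n (q - j))"

text \<open>Every element of \<open>J\<close> has value at least \<open>c\<close>, so below height \<open>n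
  c\<close> the Neumann series is stationary after \<open>n\<close> steps. The inverse lives on
  the monoid generated by \<open>J\<close>, hence in \<open>K\<close>.\<close>
lemma convolution_inverse:
  fixes val :: "'a::ab_group_add \<Rightarrow> real"
  assumes add: "\<And>x y. val (x + y) = val x + val y"
    and c: "c > 0" "\<And>j. j \<in> J \<Longrightarrow> val j \<ge> c"
    and fin: "\<And>R. finite {j \<in> J. val j \<le> R}"
    and K: "0 \<in> K" "\<And>j q. j \<in> J \<Longrightarrow> q \<in> K \<Longrightarrow> q + j \<in> K"
  obtains mu :: "'a \<Rightarrow> int" where "mu 0 = 1" "\<And>q. mu q \<noteq> 0 \<Longrightarrow> q \<in> K"
    "\<And>R. finite {q. mu q \<noteq> 0 \<and> val q \<le> R}"
    "\<And>R r. val r \<le> R \<Longrightarrow> mu r + (\<Sum>j | j \<in> J \<and> val j \<le> R. mu (r - j)) = of_bool (r = 0)"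
proof -
  have val0: "val 0 = 0" using add[of 0 0] by simp
  have valdiff: "val (x - y) = val x - val y" for x y using add[of "x - y" y] by simp
  let ?N = "neumann val J"
  have neg: "?N n q = 0" if "val q < 0" for n q
  proof (cases n)
    case (Suc k)
    have "{j. j \<in> J \<and> val j \<le> val q} = {}" using c that by force
    moreover have "q \<noteq> 0" using that val0 by auto
    ultimately show ?thesis unfolding Suc by (simp del: Collect_empty_eq)
  qed simp
  have step: "?N (Suc n) q = ?N n q" if "val q < n * c" for n q
    using that
  proof (induction n arbitrary: q)
    case 0
    then show ?case using neg[of q "Suc 0"] by simp
  next
    case (Suc n)
    have "?N (Suc n) (q - j) = ?N n (q - j)" if "j \<in> J" for j
    proof (rule Suc.IH)
      show "val (q - j) < n * c" using Suc.prems c(2)[OF that] by (simp add: valdiff algebra_simps)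
    qed
    then have "(\<Sum>j | j \<in> J \<and> val j \<le> val q. ?N (Suc n) (q - j)) =
        (\<Sum>j | j \<in> J \<and> val j \<le> val q. ?N n (q - j))"
      by (intro sum.cong) auto
    then show ?case using neumann.simps(2)[of val J n q] neumann.simps(2)[of val J "Suc n" q] by presburger
  qed
  have stable: "?N (n + k) q = ?N n q" if "val q < n * c" for n k q
  proof (induction k)
    case (Suc k)
    have "real n * c \<le> real (n + k) * c" using c(1) by (intro mult_right_mono) auto
    then have "val q < real (n + k) * c" using that by simp
    then show ?case using step[of q "n + k"] Suc by simp
  qed simp
  define idx where "idx R = nat \<lfloor>R / c\<rfloor> + 1" for R :: real
  have idx: "R < idx R * c" for R
  proof -
    have "R / c < real_of_int \<lfloor>R / c\<rfloor> + 1" by linarith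
    also have "\<dots> \<le> real (idx R)" unfolding idx_def by simp
    finally show ?thesis using c(1) by (simp add: pos_divide_less_eq)
  qed
  define mu where "mu q = ?N (idx (val q)) q" for q
  have mu: "mu q = ?N n q" if "val q < n * c" for n q
  proof (cases "n \<le> idx (val q)")
    case True
    then show ?thesis unfolding mu_def using stable[OF that, of "idx (val q) - n"] by simp
  next
    case False
    then show ?thesis unfolding mu_def using stable[OF idx, of q "n - idx (val q)"] by simp
  qed
  have munN: "mu q = ?N (idx R) q" if "val q \<le> R" for q R
    using mu[of q "idx R"] idx[of R] that by linarith
  have inK: "q \<in> K" if "?N n q \<noteq> 0" for n q
    using that
  proof (induction n arbitrary: q)
    case (Suc n)
    show ?case
    proof (cases "q = 0")
      case False
      then have "(\<Sum>j | j \<in> J \<and> val j \<le> val q. ?N n (q - j)) \<noteq> 0" using Suc.prems by simp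
      then obtain j where "j \<in> J" "?N n (q - j) \<noteq> 0"
        by (metis (mono_tags, lifting) mem_Collect_eq sum.not_neutral_contains_not_neutral)
      then show ?thesis using Suc.IH[of "q - j"] K(2)[of j "q - j"] by simp
    qed (use K in simp)
  qed simp
  have finN: "finite {q. ?N n q \<noteq> 0 \<and> val q \<le> R}" for n R
  proof (induction n)
    case (Suc n)
    let ?S = "{q. ?N n q \<noteq> 0 \<and> val q \<le> R}" and ?J = "{j \<in> J. val j \<le> R}"
    have "{q. ?N (Suc n) q \<noteq> 0 \<and> val q \<le> R} \<subseteq> insert 0 ((\<lambda>(j, q). q + j) ` (?J \<times> ?S))"
    proof
      fix q assume q: "q \<in> {q. ?N (Suc n) q \<noteq> 0 \<and> val q \<le> R}"
      show "q \<in> insert 0 ((\<lambda>(j, q). q + j) ` (?J \<times> ?S))"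
      proof (cases "q = 0")
        case False
        then have "(\<Sum>j | j \<in> J \<and> val j \<le> val q. ?N n (q - j)) \<noteq> 0" using q by simp
        then obtain j where j: "j \<in> J" "val j \<le> val q" "?N n (q - j) \<noteq> 0"
          by (metis (mono_tags, lifting) mem_Collect_eq sum.not_neutral_contains_not_neutral)
        then have "(j, q - j) \<in> ?J \<times> ?S" using q c by (fastforce simp: valdiff)
        then show ?thesis by (intro insertI2 image_eqI[of _ _ "(j, q - j)"]) auto
      qed simp
    qed
    then show ?case using Suc fin by (meson finite_SigmaI finite_imageI finite_insert finite_subset)
  qed simp
  show ?thesis
  proof (rule that)
    have "{j. j \<in> J \<and> val j \<le> 0} = {}" using c by force
    then have "?N 1 0 = 1" by (simp add: val0 del: Collect_empty_eq)
    then show "mu 0 = 1" using mu[of 0 1] c val0 by simp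
    show "q \<in> K" if "mu q \<noteq> 0" for q using inK that unfolding mu_def by blast
    show "finite {q. mu q \<noteq> 0 \<and> val q \<le> R}" for R
    proof (rule finite_subset[OF _ finN[of "idx R" R]])
      show "{q. mu q \<noteq> 0 \<and> val q \<le> R} \<subseteq> {q. ?N (idx R) q \<noteq> 0 \<and> val q \<le> R}"
        using munN by auto
    qed
    fix R r assume r: "val r \<le> R"
    have "mu r = ?N (Suc (idx (val r))) r" unfolding mu_def using step[OF idx] by simp
    also have "\<dots> = of_bool (r = 0) - (\<Sum>j | j \<in> J \<and> val j \<le> val r. mu (r - j))"
    proof -
      have "mu (r - j) = ?N (idx (val r)) (r - j)" if "j \<in> J" for j
        using munN[of "r - j" "val r"] c that by (simp add: valdiff order_trans[of 0 c])
      then show ?thesis by simp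
    qed
    also have "(\<Sum>j | j \<in> J \<and> val j \<le> val r. mu (r - j)) = (\<Sum>j | j \<in> J \<and> val j \<le> R. mu (r - j))"
    proof (rule sum.mono_neutral_left)
      show "finite {j. j \<in> J \<and> val j \<le> R}" using fin by simp
      show "\<forall>j\<in>{j. j \<in> J \<and> val j \<le> R} - {j. j \<in> J \<and> val j \<le> val r}. mu (r - j) = 0"
      proof
        fix j assume "j \<in> {j. j \<in> J \<and> val j \<le> R} - {j. j \<in> J \<and> val j \<le> val r}"
        then have "val (r - j) < 0" by (auto simp: valdiff)
        then show "mu (r - j) = 0" unfolding mu_def by (rule neg)
      qed
    qed (use r in auto)
    finally show "mu r + (\<Sum>j | j \<in> J \<and> val j \<le> R. mu (r - j)) = of_bool (r = 0)" by simp
  qed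
qed

section \<open>Tilings in normal position\<close>

text \<open>This replaces the choice of a generic point. Removing from an open set a closed set that does
  not contain it leaves a nonempty open set, and finitely many such steps suffice. Two tiles that
  meet in a point of \<open>W'\<close> then overlap on all of \<open>W'\<close>.\<close>
lemma shrink_to_decide:
  assumes "finite \<F>" "\<And>X. X \<in> \<F> \<Longrightarrow> closed X" "openin (top_of_set V) W" "W \<noteq> {}"
  obtains W' where "openin (top_of_set V) W'" "W' \<noteq> {}" "W' \<subseteq> W"
    "\<And>X. X \<in> \<F> \<Longrightarrow> W' \<subseteq> X \<or> W' \<inter> X = {}"
proof -
  have "\<exists>W'. openin (top_of_set V) W' \<and> W' \<noteq> {} \<and> W' \<subseteq> W \<and> (\<forall>X\<in>\<F>. W' \<subseteq> X \<or> W' \<inter> X = {})"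
    using assms(1,2)
  proof (induction \<F> rule: finite_induct)
    case empty
    then show ?case using assms(3,4) by blast
  next
    case (insert X \<F>)
    then obtain W' where W': "openin (top_of_set V) W'" "W' \<noteq> {}" "W' \<subseteq> W"
        "\<forall>X\<in>\<F>. W' \<subseteq> X \<or> W' \<inter> X = {}"
      by blast
    show ?case
    proof (cases "W' \<subseteq> X")
      case True
      then show ?thesis using W' by blast
    next
      case False
      have "openin (top_of_set V) (W' \<inter> - X)"
        using W'(1) insert.prems by (intro openin_Int_open) auto
      moreover have "W' \<inter> - X \<noteq> {}" using False by blast
      moreover have "\<forall>Y\<in>insert X \<F>. W' \<inter> - X \<subseteq> Y \<or> (W' \<inter> - X) \<inter> Y = {}"
        using W'(4) by blast
      ultimately show ?thesis using W'(3) by blast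
    qed
  qed
  then show ?thesis by (elim exE conjE) (rule that, auto)
qed

text \<open>Write \<open>0 = t0 + j0\<close>, and move \<open>T0\<close> by \<open>j0\<close> and
  \<open>J0\<close> by \<open>- j0\<close>. Then \<open>T\<close> and \<open>J\<close> are subsets
  of the pointed cone \<open>C\<close>, and a point of \<open>C\<close> close to \<open>0\<close>
  can only be reached with a small \<open>j\<close>. As \<open>0\<close> is isolated in
  \<open>J\<close>, that is \<open>j = 0\<close>, so \<open>T\<close> contains a neighbourhood of
  \<open>0\<close> in \<open>C\<close> and thus a relatively open ball. Two translations at a
  small distance would make translates of this ball overlap in an open set; so \<open>J\<close> is
  uniformly discrete, hence locally finite.

  Essential disjointness is recorded in its topological form: no nonempty relatively open set,
  shifted by \<open>y\<close>, lies in two tiles.\<close>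
lemma tiling_normal_form:
  fixes A :: "'a::euclidean_space set"
  assumes fin: "finite A" and \<beta>: "\<And>a. a \<in> A \<Longrightarrow> \<beta> \<bullet> a > 0" and C: "C = convex_cone hull A"
    and tiling: "translation_tiling T0 J0 C"
  obtains T J where "compact T" "T \<subseteq> C" "J \<subseteq> C" "0 \<in> J"
    "\<And>x. x \<in> C \<longleftrightarrow> (\<exists>j\<in>J. x - j \<in> T)"
    "\<And>i j W y. i \<in> J \<Longrightarrow> j \<in> J \<Longrightarrow> openin (top_of_set (span C)) W \<Longrightarrow> W \<noteq> {} \<Longrightarrow> y \<in> span C \<Longrightarrow>
       \<forall>x\<in>W. y + x - i \<in> T \<and> y + x - j \<in> T \<Longrightarrow> i = j"
    "\<And>R. finite {j \<in> J. \<beta> \<bullet> j \<le> R}"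
proof -
  have tile: "compact T0" "discrete J0" "T0 + J0 = C"
      "\<And>i j. i \<in> J0 \<Longrightarrow> j \<in> J0 \<Longrightarrow> i \<noteq> j \<Longrightarrow>
        (\<lambda>x. x + i) ` T0 \<inter> (\<lambda>x. x + j) ` T0 \<in> null_sets (lebesgue_subspace (span C))"
    using tiling unfolding translation_tiling_def by auto
  have "0 \<in> T0 + J0" using tile(3) C convex_cone_hull_contains_0 by blast
  then obtain t0 j0 where 0: "t0 \<in> T0" "j0 \<in> J0" "t0 + j0 = 0"
    unfolding set_plus_def by auto
  have t0: "t0 = - j0" using 0(3) by (simp add: eq_neg_iff_add_eq_0)
  define T where "T = (\<lambda>t. t + j0) ` T0"
  define J where "J = (\<lambda>j. j - j0) ` J0"
  have compT: "compact T" unfolding T_def by (intro compact_continuous_image continuous_intros tile)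
  have TC: "T \<subseteq> C" unfolding T_def tile(3)[symmetric] using 0(2) by auto
  have JC: "J \<subseteq> C"
  proof
    fix x assume "x \<in> J"
    then obtain j where "j \<in> J0" "x = t0 + j" unfolding J_def t0 by auto
    then show "x \<in> C" unfolding tile(3)[symmetric] using 0(1) by (auto intro: set_plus_intro)
  qed
  have 0: "0 \<in> J" unfolding J_def using 0(2) by force
  have cover: "x \<in> C \<longleftrightarrow> (\<exists>j\<in>J. x - j \<in> T)" for x
  proof
    assume "x \<in> C"
    then obtain t j where "t \<in> T0" "j \<in> J0" "x = t + j"
      unfolding tile(3)[symmetric] set_plus_def by blast
    then show "\<exists>j\<in>J. x - j \<in> T" unfolding J_def T_def by force
  next
    assume "\<exists>j\<in>J. x - j \<in> T"
    then obtain t j where "t \<in> T0" "j \<in> J0" "x - (j - j0) = t + j0"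
      unfolding J_def T_def by blast
    then have "x = t + j" by (simp add: algebra_simps)
    then show "x \<in> C" unfolding tile(3)[symmetric] using \<open>t \<in> T0\<close> \<open>j \<in> J0\<close> by (simp add: set_plus_intro)
  qed
  let ?V = "span C"
  have CV: "C \<subseteq> ?V" by (rule span_superset)
  have disj: "i = j" if ij: "i \<in> J" "j \<in> J" and W: "openin (top_of_set ?V) W" "W \<noteq> {}" and y: "y \<in> ?V"
    and sub: "\<forall>x\<in>W. y + x - i \<in> T \<and> y + x - j \<in> T" for i j W y
  proof (rule ccontr)
    assume "i \<noteq> j"
    obtain i' j' where i': "i' \<in> J0" "i = i' - j0" and j': "j' \<in> J0" "j = j' - j0"
      using ij unfolding J_def by blast
    have "(\<lambda>x. y + 1 *\<^sub>R x) ` W \<subseteq> (\<lambda>x. x + i') ` T0 \<inter> (\<lambda>x. x + j') ` T0"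
    proof
      fix z assume "z \<in> (\<lambda>x. y + 1 *\<^sub>R x) ` W"
      then have "z - i \<in> T" "z - j \<in> T" using sub by auto
      then obtain s t where "s \<in> T0" "z - i = s + j0" "t \<in> T0" "z - j = t + j0"
        unfolding T_def by blast
      then have "z = s + i'" "z = t + j'" using i' j' by (simp_all add: algebra_simps)
      then show "z \<in> (\<lambda>x. x + i') ` T0 \<inter> (\<lambda>x. x + j') ` T0"
        using \<open>s \<in> T0\<close> \<open>t \<in> T0\<close> by blast
    qed
    moreover have "openin (top_of_set ?V) ((\<lambda>x. y + 1 *\<^sub>R x) ` W)"
      by (rule openin_subspace_affinity) (use y W in auto)
    ultimately have "(\<lambda>x. x + i') ` T0 \<inter> (\<lambda>x. x + j') ` T0 \<notin> null_sets (lebesgue_subspace ?V)"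
      using W(2) by (intro openin_subspace_not_null) auto
    then show False using tile(4)[of i' j'] i' j' \<open>i \<noteq> j\<close> by auto
  qed
  obtain K where K: "K > 0" "\<And>x. x \<in> C \<Longrightarrow> norm x \<le> K * (\<beta> \<bullet> x)"
    using norm_le_inner_on_cone[OF fin \<beta>] unfolding C by metis
  have nn: "\<beta> \<bullet> x \<ge> 0" if "x \<in> C" for x
    using convex_cone_hull_inner_nonneg that \<beta> unfolding C by (metis less_imp_le)
  obtain r where r: "r > 0" "\<And>j. j \<in> J \<Longrightarrow> norm j < r \<Longrightarrow> j = 0"
  proof -
    have "j0 isolated_in J0" using tile(2) \<open>j0 \<in> J0\<close> by (rule discreteD)
    then obtain r where r: "r > 0" "\<And>j. j \<in> J0 \<Longrightarrow> dist j0 j < r \<Longrightarrow> j = j0"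
      unfolding isolated_in_dist_Ex_iff by blast
    have "j = 0" if "j \<in> J" "norm j < r" for j
    proof -
      obtain i where i: "i \<in> J0" "j = i - j0" using \<open>j \<in> J\<close> unfolding J_def by blast
      then have "dist j0 i < r" using that(2) by (simp add: dist_norm norm_minus_commute)
      then show ?thesis using r(2) i by simp
    qed
    then show ?thesis using r(1) that by blast
  qed
  have near0: "x \<in> T" if x: "x \<in> C" "\<beta> \<bullet> x < r / K" for x
  proof -
    obtain j where j: "j \<in> J" "x - j \<in> T" using cover x(1) by blast
    have "\<beta> \<bullet> j \<le> \<beta> \<bullet> x" using nn[of "x - j"] TC j(2) by (auto simp: inner_diff_right)
    then have "K * (\<beta> \<bullet> j) \<le> K * (\<beta> \<bullet> x)" using K(1) by simp
    also have "\<dots> < r" using x(2) K(1) by (simp add: pos_less_divide_eq mult.commute)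
    finally have "K * (\<beta> \<bullet> j) < r" .
    then have "norm j < r" using K(2)[of j] j(1) JC by force
    then have "j = 0" using r(2) j(1) by blast
    then show ?thesis using j(2) by simp
  qed
  define U where "U = rel_interior C \<inter> {x. \<beta> \<bullet> x < r / K}"
  have cvx: "convex C" unfolding C by (rule convex_convex_cone_hull)
  have C0: "0 \<in> C" unfolding C by (rule convex_cone_hull_contains_0)
  have aff: "affine hull C = ?V" using C0 by (intro affine_hull_span_0 hull_inc)
  have "openin (top_of_set ?V) U"
    unfolding U_def aff[symmetric] by (intro openin_Int_open openin_rel_interior open_halfspace_lt)
  moreover have "U \<noteq> {}"
  proof -
    obtain c where c: "c \<in> rel_interior C" using rel_interior_eq_empty[OF cvx] C0 by blast
    then have "\<beta> \<bullet> c \<ge> 0" using nn rel_interior_subset by blast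
    define e where "e = min 1 (r / (2 * K * (1 + \<beta> \<bullet> c)))"
    have e: "0 < e" "e \<le> 1" unfolding e_def using r(1) K(1) \<open>\<beta> \<bullet> c \<ge> 0\<close> by auto
    have "0 - e *\<^sub>R (0 - c) \<in> rel_interior C"
      using c C0 e cvx by (intro rel_interior_convex_shrink) auto
    moreover have "e * (\<beta> \<bullet> c) < r / K"
    proof -
      have "e * (\<beta> \<bullet> c) \<le> r / (2 * K * (1 + \<beta> \<bullet> c)) * (\<beta> \<bullet> c)"
        unfolding e_def using \<open>\<beta> \<bullet> c \<ge> 0\<close> by (intro mult_right_mono) auto
      also have "\<dots> = r / K * ((\<beta> \<bullet> c) / (2 * (1 + \<beta> \<bullet> c)))"
        using K(1) by (simp add: algebra_simps)
      also have "\<dots> < r / K * 1"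
        using r(1) K(1) \<open>\<beta> \<bullet> c \<ge> 0\<close> by (intro mult_strict_left_mono) (auto simp: divide_less_eq)
      finally show ?thesis by simp
    qed
    ultimately show ?thesis unfolding U_def by auto
  qed
  ultimately obtain u e where u: "u \<in> U" and e: "e > 0" "ball u e \<inter> ?V \<subseteq> U"
    unfolding openin_contains_ball by blast
  have UT: "U \<subseteq> T" unfolding U_def using near0 rel_interior_subset by blast
  have uV: "u \<in> ?V" using u CV rel_interior_subset unfolding U_def by blast
  have ud: "i = j" if ij: "i \<in> J" "j \<in> J" "dist i j < e" for i j
  proof (rule disj[OF ij(1,2)])
    have iV: "i \<in> ?V" "j \<in> ?V" using ij JC CV by blast+
    show "openin (top_of_set ?V) (?V \<inter> (ball (u + i) e \<inter> ball (u + j) e))"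
      by (intro openin_open_Int open_Int open_ball)
    have "u + i \<in> ?V \<inter> (ball (u + i) e \<inter> ball (u + j) e)"
      using ij(3) e(1) iV uV by (simp add: span_add dist_commute)
    then show "?V \<inter> (ball (u + i) e \<inter> ball (u + j) e) \<noteq> {}" by blast
    show "0 \<in> ?V" by (rule span_zero)
    show "\<forall>x\<in>?V \<inter> (ball (u + i) e \<inter> ball (u + j) e). 0 + x - i \<in> T \<and> 0 + x - j \<in> T"
    proof
      fix x assume x: "x \<in> ?V \<inter> (ball (u + i) e \<inter> ball (u + j) e)"
      then have "x - i \<in> ball u e \<inter> ?V" "x - j \<in> ball u e \<inter> ?V"
        using iV by (auto simp: span_diff dist_norm algebra_simps)
      then show "0 + x - i \<in> T \<and> 0 + x - j \<in> T" using e(2) UT by auto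
    qed
  qed
  have lf: "finite {j \<in> J. \<beta> \<bullet> j \<le> R}" for R
  proof -
    have "uniform_discrete J" unfolding uniform_discrete_def using ud e(1) by blast
    then have "uniform_discrete (J \<inter> cball 0 (K * R))" by (rule uniform_discrete_subset) simp
    then have "finite (J \<inter> cball 0 (K * R))"
      using uniform_discrete_finite_iff[of "J \<inter> cball 0 (K * R)"] by (simp add: bounded_Int)
    moreover have "{j \<in> J. \<beta> \<bullet> j \<le> R} \<subseteq> J \<inter> cball 0 (K * R)"
    proof
      fix j assume j: "j \<in> {j \<in> J. \<beta> \<bullet> j \<le> R}"
      then have "norm j \<le> K * (\<beta> \<bullet> j)" using K(2) JC by blast
      also have "\<dots> \<le> K * R" using j K(1) by simp
      finally show "j \<in> J \<inter> cball 0 (K * R)" using j by simp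
    qed
    ultimately show ?thesis by (rule finite_subset[rotated])
  qed
  show ?thesis by (rule that[OF compT TC JC 0 cover disj lf])
qed

section \<open>Recovering the tile near a face\<close>

text \<open>Associativity of convolution: the inverse, applied to the sum of the translates of
  \<open>t\<close>, gives \<open>t\<close> back. Only the value at one point is stated. In the
  application, \<open>t r\<close> tells whether \<open>x - r\<close> is in the tile, for a fixed
  \<open>x\<close>, and the height bound \<open>R\<close> keeps all sums finite.\<close>
lemma convolution_inverse_deconvolves:
  fixes val :: "'a::ab_group_add \<Rightarrow> real" and mu t :: "'a \<Rightarrow> int"
  assumes add: "\<And>x y. val (x + y) = val x + val y"
    and J: "finite {j \<in> J. val j \<le> R}" "\<And>j. j \<in> J \<Longrightarrow> val j \<ge> 0" "0 \<notin> J"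
    and fin: "finite {q. mu q \<noteq> 0 \<and> val q \<le> R}"
    and inv: "\<And>r. val r \<le> R \<Longrightarrow> mu r + (\<Sum>j | j \<in> J \<and> val j \<le> R. mu (r - j)) = of_bool (r = 0)"
    and t: "\<And>r. t r \<noteq> 0 \<Longrightarrow> val r \<le> R" and "R \<ge> 0"
  shows "(\<Sum>q | mu q \<noteq> 0 \<and> val q \<le> R. mu q * (\<Sum>j\<in>insert 0 {j \<in> J. val j \<le> R}. t (q + j))) = t 0"
proof -
  let ?Q = "{q. mu q \<noteq> 0 \<and> val q \<le> R}" and ?J = "insert 0 {j \<in> J. val j \<le> R}"
  have val0: "val 0 = 0" using add[of 0 0] by simp
  have valdiff: "val (x - y) = val x - val y" for x y using add[of "x - y" y] by simp
  define D where "D = insert 0 ((\<lambda>(q, j). q + j) ` (?Q \<times> ?J))"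
  have finJ: "finite ?J" using J by simp
  have finD: "finite D" unfolding D_def using finJ fin by blast
  have shift: "(\<Sum>q\<in>?Q. mu q * t (q + j)) = (\<Sum>r\<in>D. mu (r - j) * t r)" if j: "j \<in> ?J" for j
  proof -
    have "(\<Sum>q\<in>?Q. mu q * t (q + j)) = (\<Sum>r\<in>(\<lambda>q. q + j) ` ?Q. mu (r - j) * t r)"
      by (subst sum.reindex) (auto simp: inj_on_def)
    also have "\<dots> = (\<Sum>r\<in>D. mu (r - j) * t r)"
    proof (rule sum.mono_neutral_left[OF finD])
      show "(\<lambda>q. q + j) ` ?Q \<subseteq> D" unfolding D_def using j by force
      show "\<forall>r\<in>D - (\<lambda>q. q + j) ` ?Q. mu (r - j) * t r = 0"
      proof
        fix r assume r: "r \<in> D - (\<lambda>q. q + j) ` ?Q"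
        then have "r - j \<notin> ?Q" by force
        moreover have "val j \<ge> 0" using j J(2) val0 by auto
        ultimately show "mu (r - j) * t r = 0" using t[of r] by (auto simp: valdiff)
      qed
    qed
    finally show ?thesis .
  qed
  have "(\<Sum>q\<in>?Q. mu q * (\<Sum>j\<in>?J. t (q + j))) = (\<Sum>q\<in>?Q. \<Sum>j\<in>?J. mu q * t (q + j))"
    by (simp only: sum_distrib_left)
  also have "\<dots> = (\<Sum>j\<in>?J. \<Sum>q\<in>?Q. mu q * t (q + j))"
    by (rule sum.swap)
  also have "\<dots> = (\<Sum>j\<in>?J. \<Sum>r\<in>D. mu (r - j) * t r)"
    by (intro sum.cong shift) auto
  also have "\<dots> = (\<Sum>r\<in>D. \<Sum>j\<in>?J. mu (r - j) * t r)"
    by (rule sum.swap)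
  also have "\<dots> = (\<Sum>r\<in>D. if r = 0 then t 0 else 0)"
  proof (rule sum.cong[OF refl])
    fix r
    have "(\<Sum>j\<in>?J. mu (r - j) * t r) = (\<Sum>j\<in>?J. mu (r - j)) * t r"
      by (simp only: sum_distrib_right)
    also have "(\<Sum>j\<in>?J. mu (r - j)) = mu r + (\<Sum>j | j \<in> J \<and> val j \<le> R. mu (r - j))"
      using J by (subst sum.insert) auto
    finally show "(\<Sum>j\<in>?J. mu (r - j) * t r) = (if r = 0 then t 0 else 0)"
      using inv[of r] t[of r] by (cases "t r = 0") auto
  qed
  also have "\<dots> = t 0" using finD by (simp add: D_def)
  finally show ?thesis .
qed

lemma finite_positive_gap:
  fixes f :: "'b \<Rightarrow> real"
  assumes "finite S"
  obtains c where "c > 0" "\<And>x. x \<in> S \<Longrightarrow> f x > 0 \<Longrightarrow> c \<le> f x"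
proof
  let ?M = "insert 1 (f ` S \<inter> {0<..})"
  have fin: "finite ?M" using assms by blast
  then show "Min ?M > 0" by (subst Min_gr_iff) auto
  show "Min ?M \<le> f x" if "x \<in> S" "f x > 0" for x
    using fin that by (intro Min_le) auto
qed

text \<open>Fix \<open>p\<close> on the face \<open>m = 0\<close> and look at points \<open>p +
  \<delta>\<close>, with \<open>\<delta>\<close> a small multiple of an element of
  \<open>D\<close>, chosen generically. For \<open>q\<close> in the support of \<open>mu\<close>,
  the number of tiles \<open>T + j\<close> with \<open>j\<close> on the face that contain \<open>p
  - q + \<delta>\<close> is \<open>1\<close> if this point is in \<open>C\<close> and
  \<open>0\<close> otherwise: with respect to \<open>m\<close>, tiles based off the face stay
  above the height of \<open>\<delta>\<close>. Convolving these numbers with \<open>mu\<close>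
  recovers the indicator of \<open>T\<close> at \<open>p + \<delta>\<close>. The predicate
  \<open>\<phi>\<close> records which shifts of \<open>C\<close> are entered when moving in the
  directions \<open>D\<close>, and so keeps \<open>\<delta>\<close> out of the resulting sum.\<close>
lemma deconvolved_germ:
  fixes C T J :: "'a::euclidean_space set" and mu :: "'a \<Rightarrow> int"
  assumes T: "compact T" "T \<subseteq> C" and J: "J \<subseteq> C" "0 \<in> J"
    and cover: "\<And>x. x \<in> C \<longleftrightarrow> (\<exists>j\<in>J. x - j \<in> T)"
    and disj: "\<And>i j W y. i \<in> J \<Longrightarrow> j \<in> J \<Longrightarrow> openin (top_of_set (span C)) W \<Longrightarrow> W \<noteq> {} \<Longrightarrow> y \<in> span C \<Longrightarrow>
       \<forall>x\<in>W. y + x - i \<in> T \<and> y + x - j \<in> T \<Longrightarrow> i = j"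
    and lf: "\<And>R. finite {j \<in> J. \<beta> \<bullet> j \<le> R}"
    and \<beta>: "\<And>x. x \<in> C \<Longrightarrow> \<beta> \<bullet> x \<ge> 0" and m: "\<And>x. x \<in> C \<Longrightarrow> m \<bullet> x \<ge> 0"
    and mu: "\<And>q. mu q \<noteq> 0 \<Longrightarrow> q \<in> C \<and> m \<bullet> q = 0" "\<And>R. finite {q. mu q \<noteq> 0 \<and> \<beta> \<bullet> q \<le> R}"
      "\<And>R r. \<beta> \<bullet> r \<le> R \<Longrightarrow> mu r + (\<Sum>j | j \<in> {j \<in> J. m \<bullet> j = 0 \<and> j \<noteq> 0} \<and> \<beta> \<bullet> j \<le> R. mu (r - j)) = of_bool (r = 0)"
    and D: "openin (top_of_set (span C)) D" "D \<noteq> {}" "bounded D"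
    and \<phi>: "\<And>v. v \<in> span C \<Longrightarrow> m \<bullet> v = 0 \<Longrightarrow> \<forall>\<^sub>F s in at_right 0. \<forall>\<delta>\<in>D. (v + s *\<^sub>R \<delta> \<in> C) = \<phi> v"
    and p: "p \<in> C" "m \<bullet> p = 0"
  obtains \<delta> where "\<bar>\<beta> \<bullet> \<delta>\<bar> < 1"
    "(\<Sum>q | mu q \<noteq> 0 \<and> \<beta> \<bullet> q \<le> \<beta> \<bullet> p + 1. mu q * of_bool (\<phi> (p - q))) = of_bool (p + \<delta> \<in> T)"
proof -
  let ?V = "span C" and ?R = "\<beta> \<bullet> p + 1"
  let ?J = "{j \<in> J. m \<bullet> j = 0 \<and> j \<noteq> 0}"
  define Q where "Q = {q. mu q \<noteq> 0 \<and> \<beta> \<bullet> q \<le> ?R}"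
  have finQ: "finite Q" unfolding Q_def by (rule mu(2))
  have CV: "C \<subseteq> ?V" by (rule span_superset)
  have QV: "p - q \<in> ?V" "m \<bullet> (p - q) = 0" if "q \<in> Q" for q
    using that mu(1) p CV unfolding Q_def by (auto intro!: span_diff simp: inner_diff_right)
  \<comment> \<open>Below height \<open>c\<close> with respect to \<open>m\<close>, the only translations that matter lie on the face.\<close>
  obtain c where c0: "c > 0" "\<And>j. j \<in> {j \<in> J. \<beta> \<bullet> j \<le> ?R} \<Longrightarrow> m \<bullet> j > 0 \<Longrightarrow> c \<le> m \<bullet> j"
    using finite_positive_gap[OF lf[of ?R], of "\<lambda>j. m \<bullet> j"] by metis
  have c: "m \<bullet> j = 0" if "j \<in> J" "\<beta> \<bullet> j \<le> ?R" "m \<bullet> j < c" for j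
    using c0(2)[of j] m[of j] J(1) that by force
  obtain B where B: "B > 0" "\<And>x. x \<in> D \<Longrightarrow> norm x \<le> B" using D(3) bounded_pos by blast
  have small: "\<forall>\<^sub>F s in at_right 0. \<forall>\<delta>\<in>D. \<bar>g \<bullet> (s *\<^sub>R \<delta>)\<bar> < e" if "e > 0" for e and g :: 'a
  proof -
    have "((\<lambda>s. s * (norm g * B)) \<longlongrightarrow> 0 * (norm g * B)) (at_right 0)"
      by (intro tendsto_intros)
    then have "\<forall>\<^sub>F s in at_right 0. s * (norm g * B) < e"
      using order_tendstoD(2)[of "\<lambda>s. s * (norm g * B)" 0 "at_right 0" e] that by simp
    moreover have "\<forall>\<^sub>F s in at_right 0. (s::real) > 0"
      by (rule eventually_at_right_less)
    ultimately show ?thesis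
    proof eventually_elim
      case (elim s)
      show ?case
      proof
        fix \<delta> assume "\<delta> \<in> D"
        have "\<bar>g \<bullet> \<delta>\<bar> \<le> norm g * norm \<delta>" by (rule Cauchy_Schwarz_ineq2)
        also have "\<dots> \<le> norm g * B" using B(2)[OF \<open>\<delta> \<in> D\<close>] by (intro mult_left_mono) auto
        finally have "s * \<bar>g \<bullet> \<delta>\<bar> \<le> s * (norm g * B)"
          using elim(2) by (intro mult_left_mono) auto
        also have "\<dots> < e" by (rule elim(1))
        finally have "s * \<bar>g \<bullet> \<delta>\<bar> < e" .
        then show "\<bar>g \<bullet> (s *\<^sub>R \<delta>)\<bar> < e" using elim by (simp add: abs_mult)
      qed
    qed
  qed
  have "\<forall>\<^sub>F s in at_right 0. \<forall>q\<in>Q. \<forall>\<delta>\<in>D. (p - q + s *\<^sub>R \<delta> \<in> C) = \<phi> (p - q)"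
    using finQ \<phi> QV by (intro eventually_ball_finite) auto
  then have "\<forall>\<^sub>F s in at_right 0. s > 0 \<and> (\<forall>\<delta>\<in>D. \<bar>\<beta> \<bullet> (s *\<^sub>R \<delta>)\<bar> < 1) \<and> (\<forall>\<delta>\<in>D. \<bar>m \<bullet> (s *\<^sub>R \<delta>)\<bar> < c)
      \<and> (\<forall>q\<in>Q. \<forall>\<delta>\<in>D. (p - q + s *\<^sub>R \<delta> \<in> C) = \<phi> (p - q))"
    by (intro eventually_conj small c0(1) zero_less_one eventually_at_right_less)
  then obtain s :: real where s: "s > 0" "\<And>\<delta>. \<delta> \<in> D \<Longrightarrow> \<bar>\<beta> \<bullet> (s *\<^sub>R \<delta>)\<bar> < 1"
      "\<And>\<delta>. \<delta> \<in> D \<Longrightarrow> \<bar>m \<bullet> (s *\<^sub>R \<delta>)\<bar> < c"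
      "\<And>q \<delta>. q \<in> Q \<Longrightarrow> \<delta> \<in> D \<Longrightarrow> (p - q + s *\<^sub>R \<delta> \<in> C) = \<phi> (p - q)"
    by (auto dest: eventually_happens)
  define W where "W = (\<lambda>x. 0 + s *\<^sub>R x) ` D"
  have W: "openin (top_of_set ?V) W" "W \<noteq> {}"
    unfolding W_def using s(1) D by (auto intro!: openin_subspace_affinity simp: span_zero simp del: add_0)
  have W\<beta>: "\<bar>\<beta> \<bullet> \<delta>\<bar> < 1" and Wm: "\<bar>m \<bullet> \<delta>\<bar> < c"
    and WC: "\<And>q. q \<in> Q \<Longrightarrow> (p - q + \<delta> \<in> C) = \<phi> (p - q)" if "\<delta> \<in> W" for \<delta>
    using that s unfolding W_def by auto
  define \<F> where "\<F> = (\<lambda>(q, j). (\<lambda>x. x - (p - q - j)) ` T) ` (Q \<times> {j \<in> J. \<beta> \<bullet> j \<le> ?R})"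
  have "finite \<F>" unfolding \<F>_def using finQ lf by blast
  moreover have "closed X" if "X \<in> \<F>" for X
    using that T(1) compact_imp_closed unfolding \<F>_def
    by (auto intro!: compact_imp_closed compact_continuous_image continuous_intros)
  ultimately obtain W' where W': "openin (top_of_set ?V) W'" "W' \<noteq> {}" "W' \<subseteq> W"
      "\<And>X. X \<in> \<F> \<Longrightarrow> W' \<subseteq> X \<or> W' \<inter> X = {}"
    using shrink_to_decide[OF _ _ W] by metis
  obtain \<delta> where \<delta>: "\<delta> \<in> W'" using W'(2) by blast
  then have \<delta>W: "\<delta> \<in> W" using W'(3) by blast
  have allin: "p - q + x - j \<in> T" if "q \<in> Q" "j \<in> J" "\<beta> \<bullet> j \<le> ?R" "p - q + \<delta> - j \<in> T" "x \<in> W'" for q j x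
  proof -
    let ?X = "(\<lambda>x. x - (p - q - j)) ` T"
    have iff: "y \<in> ?X \<longleftrightarrow> p - q + y - j \<in> T" for y
      by (auto simp: image_iff algebra_simps intro!: bexI[of _ "p - q + y - j"])
    have "?X \<in> \<F>" unfolding \<F>_def using that(1-3) by force
    moreover have "\<delta> \<in> ?X" using iff that(4) by blast
    ultimately have "W' \<subseteq> ?X" using W'(4) \<delta> by blast
    then show ?thesis using iff that(5) by blast
  qed
  define t :: "'a \<Rightarrow> int" where "t r = of_bool (p + \<delta> - r \<in> T)" for r
  have "(\<Sum>j\<in>insert 0 {j \<in> ?J. \<beta> \<bullet> j \<le> ?R}. t (q + j)) = of_bool (\<phi> (p - q))" if q: "q \<in> Q" for q
  proof -
    let ?I = "insert 0 {j \<in> ?J. \<beta> \<bullet> j \<le> ?R}"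
    have finI: "finite ?I" using lf[of ?R] by (auto elim: rev_finite_subset)
    have IJ: "j \<in> J \<and> \<beta> \<bullet> j \<le> ?R" if "j \<in> ?I" for j using that J(2) \<beta>[OF p(1)] by auto
    have t: "t (q + j) = of_bool (p - q + \<delta> - j \<in> T)" for j
      unfolding t_def by (simp add: algebra_simps)
    show ?thesis
    proof (cases "\<phi> (p - q)")
      case False
      then have "p - q + \<delta> \<notin> C" using WC[OF \<delta>W q] by blast
      then have "t (q + j) = 0" if "j \<in> ?I" for j
        using cover IJ[OF that] unfolding t by auto
      then show ?thesis using False by (simp del: sum.insert)
    next
      case True
      then have "p - q + \<delta> \<in> C" using WC[OF \<delta>W q] by blast
      then obtain i where i: "i \<in> J" "p - q + \<delta> - i \<in> T" using cover by blast
      then have "p - q + \<delta> - i \<in> C" using T(2) by blast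
      from m[OF this] have mi: "m \<bullet> i \<le> m \<bullet> \<delta>" using QV(2)[OF q] by (simp add: inner_diff_right inner_add_right)
      have "q \<in> C" using q mu(1) unfolding Q_def by blast
      then have "\<beta> \<bullet> i \<le> ?R"
        using \<beta>[OF \<open>p - q + \<delta> - i \<in> C\<close>] \<beta>[OF \<open>q \<in> C\<close>] W\<beta>[OF \<delta>W] by (simp add: inner_diff_right inner_add_right)
      then have iI: "i \<in> ?I" using c[OF i(1)] mi Wm[OF \<delta>W] i(1) by auto
      have "t (q + j) = (if j = i then 1 else 0)" if j: "j \<in> ?I" for j
      proof (cases "p - q + \<delta> - j \<in> T")
        case True
        have "\<forall>x\<in>W'. p - q + x - i \<in> T \<and> p - q + x - j \<in> T"
          using allin[OF q _ _ i(2)] allin[OF q _ _ True] IJ[OF iI] IJ[OF j] by blast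
        then have "i = j"
          using disj[OF i(1) _ W'(1,2) QV(1)[OF q]] IJ[OF j] by blast
        then show ?thesis using True unfolding t by simp
      next
        case False
        then show ?thesis using i(2) unfolding t by auto
      qed
      then have "(\<Sum>j\<in>?I. t (q + j)) = (\<Sum>j\<in>?I. if j = i then 1 else 0)"
        by (intro sum.cong) auto
      also have "\<dots> = 1" using finI iI by (simp only: sum.delta' sum.delta if_True)
      finally show ?thesis using True by simp
    qed
  qed
  then have "(\<Sum>q\<in>Q. mu q * of_bool (\<phi> (p - q))) =
      (\<Sum>q\<in>Q. mu q * (\<Sum>j\<in>insert 0 {j \<in> ?J. \<beta> \<bullet> j \<le> ?R}. t (q + j)))"
    by (intro sum.cong) auto
  also have "\<dots> = t 0"
    unfolding Q_def
  proof (rule convolution_inverse_deconvolves)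
    show "finite {j \<in> ?J. \<beta> \<bullet> j \<le> ?R}" using lf[of ?R] by (auto elim: rev_finite_subset)
    show "\<beta> \<bullet> r \<le> ?R" if "t r \<noteq> 0" for r
    proof -
      have "p + \<delta> - r \<in> C" using that T(2) unfolding t_def by (auto simp: of_bool_def split: if_splits)
      from \<beta>[OF this] show ?thesis using W\<beta>[OF \<delta>W] by (simp add: inner_diff_right inner_add_right)
    qed
    show "?R \<ge> 0" using \<beta>[OF p(1)] by simp
  qed (use mu J \<beta> in \<open>auto simp: inner_add_right\<close>)
  also have "\<dots> = of_bool (p + \<delta> \<in> T)" unfolding t_def by simp
  finally show ?thesis using that[of \<delta>] W\<beta>[OF \<delta>W] unfolding Q_def by blast
qed

section \<open>Two ways of approaching a face\<close>

lemma eventually_shift_notin_closed: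
  fixes C :: "'a::real_normed_vector set"
  assumes "closed C" "v \<notin> C" "bounded D"
  shows "\<forall>\<^sub>F s in at_right 0. \<forall>\<delta>\<in>D. v + s *\<^sub>R \<delta> \<notin> C"
proof -
  obtain e where e: "e > 0" "ball v e \<subseteq> - C" using assms(1,2) by (meson ComplI open_Compl open_contains_ball)
  obtain B where B: "B > 0" "\<And>x. x \<in> D \<Longrightarrow> norm x \<le> B" using assms(3) bounded_pos by blast
  have "\<forall>\<^sub>F s in at_right 0. (s::real) < e / B"
    using e(1) B(1) by (intro eventually_at_rightI[of 0 "e / B"]) auto
  moreover have "\<forall>\<^sub>F s in at_right 0. (s::real) > 0" by (rule eventually_at_right_less)
  ultimately show ?thesis
  proof eventually_elim
    case (elim s)
    show ?case
    proof
      fix \<delta> assume "\<delta> \<in> D"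
      have "norm (s *\<^sub>R \<delta>) \<le> s * B" using elim(2) B(2)[OF \<open>\<delta> \<in> D\<close>] by simp
      also have "\<dots> < e" using elim(1) B(1) by (simp add: pos_less_divide_eq)
      finally have "v + s *\<^sub>R \<delta> \<in> ball v e" by (simp add: dist_norm)
      then show "v + s *\<^sub>R \<delta> \<notin> C" using e(2) by blast
    qed
  qed
qed

lemma eventually_shift_by_inside_direction:
  fixes C D :: "'a::real_normed_vector set"
  assumes "closed C" "convex_cone C" "bounded D" "D \<subseteq> C"
  shows "\<forall>\<^sub>F s in at_right 0. \<forall>\<delta>\<in>D. (v + s *\<^sub>R \<delta> \<in> C) = (v \<in> C)"
proof (cases "v \<in> C")
  case True
  then have "\<forall>\<delta>\<in>D. v + s *\<^sub>R \<delta> \<in> C" if "s > 0" for s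
    using that assms(4) convex_cone_add[OF assms(2)] convex_cone_scaleR[OF assms(2)]
    by (simp add: subset_iff)
  then show ?thesis using True eventually_at_right_less[of "0::real"] by (auto elim: eventually_mono)
next
  case False
  show ?thesis using eventually_shift_notin_closed[OF assms(1) False assms(3)] False by simp
qed

text \<open>Small positive multiples of \<open>\<delta>\<close> leave \<open>C\<close> from the apex only:
  from any other point of the face spanned by \<open>a\<close> and \<open>b\<close>, a piece
  \<open>s *\<^sub>R a\<close> or \<open>s *\<^sub>R b\<close> can be split off and absorbs
  \<open>s *\<^sub>R \<delta>\<close>.\<close>
lemma eventually_shift_by_outside_direction:
  fixes C D :: "'a::real_normed_vector set"
  assumes closed: "closed C" and cone: "convex_cone C" and D: "bounded D"
      "\<And>x. x \<in> D \<Longrightarrow> x \<notin> C \<and> x + a \<in> C \<and> x + b \<in> C"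
    and coords: "\<And>s t. s *\<^sub>R a + t *\<^sub>R b \<in> C \<longleftrightarrow> s \<ge> 0 \<and> t \<ge> 0"
    and "v \<in> C \<Longrightarrow> \<exists>s t. v = s *\<^sub>R a + t *\<^sub>R b"
  shows "\<forall>\<^sub>F s in at_right 0. \<forall>\<delta>\<in>D. (v + s *\<^sub>R \<delta> \<in> C) = (v \<in> C \<and> v \<noteq> 0)"
proof -
  note add_C = convex_cone_add[OF cone] and scale_C = convex_cone_scaleR[OF cone]
  have C0: "0 \<in> C" using cone by (rule convex_cone_contains_0)
  show ?thesis
  proof (cases "v \<in> C")
    case True
    then obtain x y where xy: "v = x *\<^sub>R a + y *\<^sub>R b" using assms(6) by blast
    then have nn: "x \<ge> 0" "y \<ge> 0" using True coords by auto
    have "(- x) *\<^sub>R a + (- y) *\<^sub>R b = - v" unfolding xy by simp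
    then have nz: "v \<noteq> 0" if "x > 0 \<or> y > 0"
      using coords[of "- x" "- y"] that C0 by auto
    have ev: "\<forall>\<^sub>F s in at_right 0. \<forall>\<delta>\<in>D. v + s *\<^sub>R \<delta> \<in> C"
      if "z > 0" "w \<in> C" "v = w + z *\<^sub>R e" "\<And>\<delta>. \<delta> \<in> D \<Longrightarrow> \<delta> + e \<in> C" "e \<in> C" for z w e
    proof (rule eventually_at_rightI[OF _ that(1)])
      fix s assume s: "s \<in> {0<..<z}"
      show "\<forall>\<delta>\<in>D. v + s *\<^sub>R \<delta> \<in> C"
      proof
        fix \<delta> assume "\<delta> \<in> D"
        have "v + s *\<^sub>R \<delta> = w + (s *\<^sub>R (\<delta> + e) + (z - s) *\<^sub>R e)"
          using that(3) by (simp add: algebra_simps)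
        moreover have "s *\<^sub>R (\<delta> + e) \<in> C" "(z - s) *\<^sub>R e \<in> C"
          using s that(5) that(4)[OF \<open>\<delta> \<in> D\<close>] by (auto intro: scale_C)
        ultimately show "v + s *\<^sub>R \<delta> \<in> C" using that(2) by (simp add: add_C)
      qed
    qed
    have abC: "a \<in> C" "b \<in> C" using coords[of 1 0] coords[of 0 1] by auto
    consider "v = 0" | "x > 0" | "y > 0" using xy nn by fastforce
    then show ?thesis
    proof cases
      case 1
      have "\<forall>\<delta>\<in>D. s *\<^sub>R \<delta> \<notin> C" if "s > 0" for s
      proof
        fix \<delta> assume "\<delta> \<in> D"
        show "s *\<^sub>R \<delta> \<notin> C"
        proof
          assume "s *\<^sub>R \<delta> \<in> C"
          then have "\<delta> \<in> C" using that scale_C[of "1 / s" "s *\<^sub>R \<delta>"] by simp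
          then show False using D(2)[OF \<open>\<delta> \<in> D\<close>] by simp
        qed
      qed
      then show ?thesis using 1 eventually_at_right_less[of "0::real"] by (auto elim: eventually_mono)
    next
      case 2
      have "\<forall>\<^sub>F s in at_right 0. \<forall>\<delta>\<in>D. v + s *\<^sub>R \<delta> \<in> C"
        using xy 2 nn abC D(2) by (intro ev[of x "y *\<^sub>R b" a]) (auto intro: scale_C)
      moreover have "v \<noteq> 0" using nz 2 by blast
      ultimately show ?thesis using True by simp
    next
      case 3
      have "\<forall>\<^sub>F s in at_right 0. \<forall>\<delta>\<in>D. v + s *\<^sub>R \<delta> \<in> C"
        using xy 3 nn abC D(2) by (intro ev[of y "x *\<^sub>R a" b]) (auto intro: scale_C)
      moreover have "v \<noteq> 0" using nz 3 by blast
      ultimately show ?thesis using True by simp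
    qed
  next
    case False
    show ?thesis using eventually_shift_notin_closed[OF closed False D(1)] False by simp
  qed
qed

section \<open>Irregular cones admit no translation tiling\<close>

theorem corollary1p1:
  fixes C :: "(real ^ 'n) set"
  assumes "irregular_cone C"
  shows "\<not> (\<exists>T J :: (real ^ 'n) set. compact T \<and> discrete J \<and> translation_tiling T J C)"
proof
  assume "\<exists>T J :: (real ^ 'n) set. compact T \<and> discrete J \<and> translation_tiling T J C"
  then obtain T0 J0 :: "(real ^ 'n) set" where tiling: "translation_tiling T0 J0 C" by blast
  obtain A \<beta> m a b D where A: "finite A" "C = convex_cone hull A" and \<beta>A: "\<And>x. x \<in> A \<Longrightarrow> \<beta> \<bullet> x > 0"
    and abA: "a \<in> A" "b \<in> A" and m: "\<And>x. x \<in> C \<Longrightarrow> m \<bullet> x \<ge> 0" "m \<bullet> a = 0" "m \<bullet> b = 0"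
    and face: "\<And>x. x \<in> C \<Longrightarrow> m \<bullet> x = 0 \<Longrightarrow> \<exists>s t. x = s *\<^sub>R a + t *\<^sub>R b"
    and coords: "\<And>s t. s *\<^sub>R a + t *\<^sub>R b \<in> C \<longleftrightarrow> s \<ge> 0 \<and> t \<ge> 0"
    and D: "openin (top_of_set (span C)) D" "D \<noteq> {}" "bounded D"
      "\<And>x. x \<in> D \<Longrightarrow> x \<notin> C \<and> x + a \<in> C \<and> x + b \<in> C"
    by (rule irregular_cone_geometry[OF assms]) (rule that)
  obtain T J where T: "compact T" "T \<subseteq> C" and J: "J \<subseteq> C" "0 \<in> J"
    and cover: "\<And>x. x \<in> C \<longleftrightarrow> (\<exists>j\<in>J. x - j \<in> T)"
    and disj: "\<And>i j W y. i \<in> J \<Longrightarrow> j \<in> J \<Longrightarrow> openin (top_of_set (span C)) W \<Longrightarrow> W \<noteq> {} \<Longrightarrow> y \<in> span C \<Longrightarrow>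
       \<forall>x\<in>W. y + x - i \<in> T \<and> y + x - j \<in> T \<Longrightarrow> i = j"
    and lf: "\<And>R. finite {j \<in> J. \<beta> \<bullet> j \<le> R}"
    by (rule tiling_normal_form[OF A(1) \<beta>A A(2) tiling]) (assumption, rule that)
  have add_C: "x + y \<in> C" if "x \<in> C" "y \<in> C" for x y
    using that unfolding A(2) by (rule convex_cone_hull_add)
  have cone: "convex_cone C" unfolding A(2) by (rule convex_cone_convex_cone_hull)
  have C0: "0 \<in> C" unfolding A(2) by (rule convex_cone_hull_contains_0)
  have closed: "closed C" unfolding A(2) by (rule closed_convex_cone_hull[OF A(1) \<beta>A])
  have \<beta>: "\<beta> \<bullet> x \<ge> 0" if "x \<in> C" for x
    using convex_cone_hull_inner_nonneg that \<beta>A unfolding A(2) by (metis less_imp_le)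
  obtain K where K: "K > 0" "\<And>x. x \<in> C \<Longrightarrow> norm x \<le> K * (\<beta> \<bullet> x)"
    using norm_le_inner_on_cone[OF A(1) \<beta>A] unfolding A(2) by metis
  \<comment> \<open>The nonzero translations on the face, and their convolution inverse\<close>
  define N where "N = {j \<in> J. m \<bullet> j = 0 \<and> j \<noteq> 0}"
  have lfN: "finite {j \<in> N. \<beta> \<bullet> j \<le> R}" for R
    unfolding N_def using lf[of R] by (auto elim: rev_finite_subset)
  have pos: "\<beta> \<bullet> j > 0" if "j \<in> N" for j
  proof -
    have "norm j > 0" "j \<in> C" using that J(1) unfolding N_def by auto
    then have "K * (\<beta> \<bullet> j) > 0" using K(2)[of j] by linarith
    then show ?thesis using K(1) by (simp add: zero_less_mult_iff)
  qed
  obtain c0 where c0: "c0 > 0" "\<And>j. j \<in> {j \<in> N. \<beta> \<bullet> j \<le> 1} \<Longrightarrow> \<beta> \<bullet> j > 0 \<Longrightarrow> c0 \<le> \<beta> \<bullet> j"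
    using finite_positive_gap[OF lfN[of 1], of "\<lambda>j. \<beta> \<bullet> j"] by metis
  define c where "c = min 1 c0"
  have c: "c > 0" unfolding c_def using c0(1) by simp
  have cle: "\<beta> \<bullet> j \<ge> c" if "j \<in> N" for j
    using c0(2)[of j] pos[OF that] that unfolding c_def by fastforce
  have F_add: "q + j \<in> {x \<in> C. m \<bullet> x = 0}" if "j \<in> N" "q \<in> {x \<in> C. m \<bullet> x = 0}" for j q
    using that J(1) add_C unfolding N_def by (auto simp: inner_add_right)
  obtain mu :: "real ^ 'n \<Rightarrow> int" where mu0: "mu 0 = 1" and muF: "\<And>q. mu q \<noteq> 0 \<Longrightarrow> q \<in> {x \<in> C. m \<bullet> x = 0}"
    and mufin: "\<And>R. finite {q. mu q \<noteq> 0 \<and> \<beta> \<bullet> q \<le> R}"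
    and inv: "\<And>R r. \<beta> \<bullet> r \<le> R \<Longrightarrow> mu r + (\<Sum>j | j \<in> N \<and> \<beta> \<bullet> j \<le> R. mu (r - j)) = of_bool (r = 0)"
    using convolution_inverse[of "\<lambda>x. \<beta> \<bullet> x" c N "{x \<in> C. m \<bullet> x = 0}"] c cle lfN F_add C0
    by (auto simp: inner_add_right)
  have muCm: "q \<in> C \<and> m \<bullet> q = 0" if "mu q \<noteq> 0" for q using muF[OF that] by blast
  obtain B where B: "\<And>x. x \<in> T \<Longrightarrow> \<beta> \<bullet> x \<le> B"
  proof -
    have "bounded T" using T(1) by (rule compact_imp_bounded)
    then obtain M where M: "\<And>x. x \<in> T \<Longrightarrow> norm x \<le> M" unfolding bounded_iff by blast
    have "\<beta> \<bullet> x \<le> norm \<beta> * M" if "x \<in> T" for x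
    proof -
      have "\<beta> \<bullet> x \<le> norm \<beta> * norm x" by (rule norm_cauchy_schwarz)
      also have "\<dots> \<le> norm \<beta> * M" using M[OF that] by (intro mult_left_mono) auto
      finally show ?thesis .
    qed
    then show ?thesis by (rule that)
  qed
  define S where "S p = {q. mu q \<noteq> 0 \<and> \<beta> \<bullet> q \<le> \<beta> \<bullet> p + 1}" for p
  define M where "M p = (\<Sum>q\<in>S p. mu q * of_bool (p - q \<in> C))" for p
  have germ: "\<exists>\<delta>. \<bar>\<beta> \<bullet> \<delta>\<bar> < 1 \<and> (\<Sum>q\<in>S p. mu q * of_bool (\<phi> (p - q))) = of_bool (p + \<delta> \<in> T)"
    if E: "openin (top_of_set (span C)) E" "E \<noteq> {}" "bounded E"
      and \<phi>: "\<And>v. m \<bullet> v = 0 \<Longrightarrow> \<forall>\<^sub>F s in at_right 0. \<forall>\<delta>\<in>E. (v + s *\<^sub>R \<delta> \<in> C) = \<phi> v"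
      and p: "p \<in> C" "m \<bullet> p = 0" for E \<phi> p
  proof (rule deconvolved_germ[of T C J \<beta> m mu E \<phi> p])
    show "\<forall>\<^sub>F s in at_right 0. \<forall>\<delta>\<in>E. (v + s *\<^sub>R \<delta> \<in> C) = \<phi> v" if "m \<bullet> v = 0" for v
      using that by (rule \<phi>)
    show ?thesis if "\<bar>\<beta> \<bullet> \<delta>\<bar> < 1"
        "(\<Sum>q | mu q \<noteq> 0 \<and> \<beta> \<bullet> q \<le> \<beta> \<bullet> p + 1. mu q * of_bool (\<phi> (p - q))) = of_bool (p + \<delta> \<in> T)" for \<delta>
      using that unfolding S_def by blast
  qed (fact T J cover disj lf \<beta> m(1) muCm mufin inv[unfolded N_def] E p)+
  have finS: "finite (S p)" for p unfolding S_def by (rule mufin)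
  \<comment> \<open>Approaching \<open>p\<close> from inside \<open>C\<close>: \<open>M p\<close> is a value of the indicator function of \<open>T\<close>.\<close>
  have M: "M p \<ge> 0" "\<beta> \<bullet> p \<ge> B + 1 \<Longrightarrow> M p = 0" if p: "p \<in> C" "m \<bullet> p = 0" for p
  proof -
    let ?D = "rel_interior C \<inter> ball 0 1"
    have aff: "affine hull C = span C" using C0 by (intro affine_hull_span_0 hull_inc)
    have cvx: "convex C" unfolding A(2) by (rule convex_convex_cone_hull)
    have 1: "openin (top_of_set (span C)) ?D"
      unfolding aff[symmetric] by (intro openin_Int_open openin_rel_interior open_ball)
    have 2: "?D \<noteq> {}"
    proof -
      have "0 \<in> closure (rel_interior C)" using convex_closure_rel_interior[OF cvx] C0 closure_subset by blast
      then obtain x where "x \<in> rel_interior C" "dist x 0 < 1"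
        unfolding closure_approachable using zero_less_one by blast
      then have "x \<in> ?D" by simp
      then show ?thesis by blast
    qed
    have 3: "bounded ?D" by (simp add: bounded_Int)
    have 4: "\<forall>\<^sub>F s in at_right 0. \<forall>\<delta>\<in>?D. (v + s *\<^sub>R \<delta> \<in> C) = (v \<in> C)" for v
      using rel_interior_subset[of C] by (intro eventually_shift_by_inside_direction closed cone 3) blast
    obtain \<delta> where \<delta>: "\<bar>\<beta> \<bullet> \<delta>\<bar> < 1" "M p = of_bool (p + \<delta> \<in> T)"
      using germ[OF 1 2 3 4 p] unfolding M_def by blast
    show "M p \<ge> 0" unfolding \<delta>(2) by simp
    show "M p = 0" if "\<beta> \<bullet> p \<ge> B + 1"
      using B[of "p + \<delta>"] that \<delta>(1) unfolding \<delta>(2) by (auto simp: inner_add_right)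
  qed
  \<comment> \<open>Approaching \<open>p\<close> in the directions \<open>D\<close> loses exactly the term with \<open>q = p\<close>.\<close>
  have M': "M p - mu p \<ge> 0" "\<beta> \<bullet> p \<ge> B + 1 \<Longrightarrow> M p - mu p = 0" if p: "p \<in> C" "m \<bullet> p = 0" for p
  proof -
    have 4: "\<forall>\<^sub>F s in at_right 0. \<forall>\<delta>\<in>D. (v + s *\<^sub>R \<delta> \<in> C) = (v \<in> C \<and> v \<noteq> 0)" if v: "m \<bullet> v = 0" for v
      using eventually_shift_by_outside_direction[OF closed cone D(3,4) coords face] v by blast
    obtain \<delta> where \<delta>: "\<bar>\<beta> \<bullet> \<delta>\<bar> < 1"
        "(\<Sum>q\<in>S p. mu q * of_bool (p - q \<in> C \<and> p - q \<noteq> 0)) = of_bool (p + \<delta> \<in> T)"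
      using germ[OF D(1-3) 4 p] by blast
    have "M p - (\<Sum>q\<in>S p. mu q * of_bool (p - q \<in> C \<and> p - q \<noteq> 0)) = (\<Sum>q\<in>S p. if q = p then mu q else 0)"
      unfolding M_def sum_subtractf[symmetric] using C0 by (intro sum.cong) auto
    also have "\<dots> = mu p" using finS by (simp add: S_def)
    finally have eq: "M p - mu p = of_bool (p + \<delta> \<in> T)" using \<delta>(2) by simp
    show "M p - mu p \<ge> 0" unfolding eq by simp
    show "M p - mu p = 0" if "\<beta> \<bullet> p \<ge> B + 1"
      using B[of "p + \<delta>"] that \<delta>(1) unfolding eq by (auto simp: inner_add_right)
  qed
  \<comment> \<open>Far away both \<open>M p\<close> and \<open>M p - mu p\<close> vanish, and hence so does \<open>mu p\<close>.\<close>
  define U where "U = {q. mu q \<noteq> 0}"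
  have "U \<subseteq> {q. mu q \<noteq> 0 \<and> \<beta> \<bullet> q \<le> B + 1}"
  proof
    fix q assume "q \<in> U"
    then show "q \<in> {q. mu q \<noteq> 0 \<and> \<beta> \<bullet> q \<le> B + 1}"
      using M(2)[of q] M'(2)[of q] muCm[of q] unfolding U_def by force
  qed
  then have finU: "finite U" using mufin finite_subset by blast
  \<comment> \<open>Coordinates on the face, in which membership in \<open>C\<close> is the componentwise order\<close>
  define e where "e z = fst z *\<^sub>R a + snd z *\<^sub>R b" for z :: "real \<times> real"
  have e_diff: "e z - e z' = (fst z - fst z') *\<^sub>R a + (snd z - snd z') *\<^sub>R b" for z z'
    unfolding e_def by (simp add: algebra_simps)
  have e_C: "e z \<in> C \<longleftrightarrow> 0 \<le> fst z \<and> 0 \<le> snd z" for z unfolding e_def by (rule coords)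
  have e_le: "e z - e z' \<in> C \<longleftrightarrow> fst z' \<le> fst z \<and> snd z' \<le> snd z" for z z'
    unfolding e_diff coords by simp
  have inj: "inj e"
  proof
    fix z z' assume "e z = e z'"
    then have "e z - e z' \<in> C" "e z' - e z \<in> C" using C0 by auto
    then show "z = z'" unfolding e_le by (simp add: prod_eq_iff)
  qed
  have me: "m \<bullet> e z = 0" for z unfolding e_def using m by (simp add: inner_add_right)
  define G where "G = e -` U"
  have eG: "e ` G = U"
  proof -
    have "U \<subseteq> range e"
    proof
      fix q assume "q \<in> U"
      then obtain s t where "q = s *\<^sub>R a + t *\<^sub>R b" using face muCm unfolding U_def by blast
      then have "q = e (s, t)" unfolding e_def by simp
      then show "q \<in> range e" by blast
    qed
    then show ?thesis unfolding G_def by blast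
  qed
  define g where "g z = mu (e z)" for z
  define L where "L x y = (\<Sum>z | z \<in> G \<and> fst z \<le> x \<and> snd z \<le> y. g z)" for x y
  have GC: "0 \<le> fst z \<and> 0 \<le> snd z" if "z \<in> G" for z
    using muCm e_C that unfolding G_def U_def by blast
  have L_M: "L x y = M (e (x, y))" for x y
  proof -
    have "M (e (x, y)) = (\<Sum>q\<in>{q \<in> S (e (x, y)). e (x, y) - q \<in> C}. mu q)"
      unfolding M_def using finS by (simp add: of_bool_def if_distrib[of "\<lambda>c. mu _ * c"] sum.If_cases Int_def cong: if_cong)
    also have "{q \<in> S (e (x, y)). e (x, y) - q \<in> C} = e ` {z. z \<in> G \<and> fst z \<le> x \<and> snd z \<le> y}"
    proof -
      have "\<beta> \<bullet> q \<le> \<beta> \<bullet> e (x, y) + 1" if "e (x, y) - q \<in> C" for q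
        using \<beta>[OF that] by (simp add: inner_diff_right)
      then have "{q \<in> S (e (x, y)). e (x, y) - q \<in> C} = {q \<in> U. e (x, y) - q \<in> C}"
        unfolding S_def U_def by blast
      then show ?thesis unfolding eG[symmetric] using e_le[of "(x, y)"] by auto
    qed
    also have "(\<Sum>q\<in>e ` {z. z \<in> G \<and> fst z \<le> x \<and> snd z \<le> y}. mu q) = L x y"
      unfolding L_def g_def using inj by (subst sum.reindex) (auto intro: inj_on_subset)
    finally show ?thesis by simp
  qed
  have L0: "L x y = 0" if "x < 0 \<or> y < 0" for x y
    unfolding L_def using GC that by (intro sum.neutral) force
  show False
  proof (rule corner_contradiction[of G g L])
    show "finite G" unfolding G_def using finU inj by (intro finite_vimageI)
    have "e (0, 0) = 0" unfolding e_def by simp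
    then have "(0, 0) \<in> G" unfolding G_def U_def using mu0 by simp
    then show "G \<noteq> {}" by blast
    show "g z \<noteq> 0" if "z \<in> G" for z using that unfolding G_def U_def g_def by blast
    show "L x y = (\<Sum>z | z \<in> G \<and> fst z \<le> x \<and> snd z \<le> y. g z)" for x y unfolding L_def ..
    show "L x y \<ge> 0" for x y
    proof (cases "x < 0 \<or> y < 0")
      case False
      then show ?thesis unfolding L_M by (intro M(1) me) (simp add: e_C)
    qed (simp add: L0)
    show "L x y - g (x, y) \<ge> 0" if "(x, y) \<in> G" for x y
      unfolding L_M g_def using GC[OF that] by (intro M'(1) me) (simp add: e_C)
    let ?R = "max 0 (max ((B + 1) / (\<beta> \<bullet> a)) ((B + 1) / (\<beta> \<bullet> b)))"
    have \<beta>ab: "\<beta> \<bullet> a > 0" "\<beta> \<bullet> b > 0" using \<beta>A abA by auto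
    show "L x y = 0" if "x \<ge> ?R \<or> y \<ge> ?R" for x y
    proof (cases "x < 0 \<or> y < 0")
      case False
      have "B + 1 \<le> x * (\<beta> \<bullet> a) \<or> B + 1 \<le> y * (\<beta> \<bullet> b)"
        using that \<beta>ab by (auto simp: pos_divide_le_eq)
      moreover have "0 \<le> x * (\<beta> \<bullet> a)" "0 \<le> y * (\<beta> \<bullet> b)" using False \<beta>ab by auto
      ultimately have "\<beta> \<bullet> e (x, y) \<ge> B + 1" unfolding e_def by (auto simp: inner_add_right)
      then show ?thesis unfolding L_M using False by (intro M(2) me) (auto simp: e_C)
    qed (simp add: L0)
  qed
qed

end
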